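(* Fix a nonnegative integer $b$ and a rational number $c\in(b,\infty)$. Let $m=m(N)$ satisfy $m(N)\to\infty$ and $m(N)^2/N\to0$ as $N\to\infty$. Then as $N\to\infty$, with respect to the measures $P_{N,b,m}$, the sequence of number-density measures $\Theta_{N,b}$ satisfies the large deviation principle on $\mathcal P_{\mathbb N_b,c}$ with rate function $R(\cdot\,|\,\rho_{b,\alpha_b(c)})$ in the following sense. (a) $R(\theta|\rho_{b,\alpha_b(c)})$ maps $\mathcal P_{\mathbb N_b,c}$ into $[0,\infty]$, and for any $M<\infty$ the level set $\{\theta\in\mathcal P_{\mathbb N_b,c}:R(\theta|\rho_{b,\alpha_b(c)})\le M\}$ is compact. (b) For any compact subset $F$ of $\mathcal P_{\mathbb N_b,c}$, $$\limsup_{N\to\infty}\frac1N\log P_{N,b,m}(\Theta_{N,b}\in F)\le -R(F|\rho_{b,\alpha_b(c)}).$$ (c) For any closed subset $F$ of $\mathcal P_{\mathbb N_b,c}$, let $\overline F$ denote the closure of $F$ in $\mathcal P_{\mathbb N_b,[b,c]}$. Then $$\limsup_{N\to\infty}\frac1N\log P_{N,b,m}(\Theta_{N,b}\in F)\le -R(\overline F|\rho_{b,\alpha_b(c)}).$$ (d) For any open subset $G$ of $\mathcal P_{\mathbb N_b,c}$, $$\liminf_{N\to\infty}\frac1N\log P_{N,b,m}(\Theta_{N,b}\in G)\ge -R(G|\rho_{b,\alpha_b(c)}).$$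
   Context: Notation: $\mathbb N_b=\{n\in\mathbb Z:n\ge b\}$. $N$ ranges only over integers $N\ge2$ for which $K:=cN$ is an integer, and limits $N\to\infty$ are along such $N$. $m=m(N)$ is an integer with $2\le m(N)\le N$. Model: $\Lambda_N=\{1,\dots,N\}$ and $\Omega_N=\Lambda_N^K$ is the set of $\omega=(\omega_1,\dots,\omega_K)$ ($\omega_i$ is the site of the $i$th of $K$ distinguishable particles). For $\ell\in\Lambda_N$, $K_\ell(\omega)=\mathrm{card}\{i:\omega_i=\ell\}$; for integers $j\ge0$, $N_j(\omega)=\mathrm{card}\{\ell\in\Lambda_N:K_\ell(\omega)=j\}$; $|N(\omega)|_+=\mathrm{card}\{j\in\mathbb N_b:N_j(\omega)\ge1\}$. Set $\Omega_{N,b,m}=\{\omega\in\Omega_N:K_\ell(\omega)\ge b\ \forall\ell\in\Lambda_N,\ |N(\omega)|_+\le m(N)\}$, and let $P_{N,b,m}$ be the uniform probability measure on the finite set $\Omega_{N,b,m}$. The number-density measure $\Theta_{N,b}(\omega)$, $\omega\in\Omega_{N,b,m}$, is the probability measure on $\mathbb N_b$ giving mass $N_j(\omega)/N$ to each $j\in\mathbb N_b$; it has mean $K/N=c$. Spaces: $\mathcal P_{\mathbb N_b}$ is the set of probability measures $\theta=\sum_{j\in\mathbb N_b}\theta_j\delta_j$ on $\mathbb N_b$ with the topology of weak convergence (metrized by the Prohorov metric); $\mathcal P_{\mathbb N_b,c}$ is the subset of measures with mean $c$; $\mathcal P_{\mathbb N_b,[b,c]}$ is the subset of measures with mean in $[b,c]$.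 Both carry the subspace topology. Poisson-type distribution: for $\alpha>0$, $\rho_{b,\alpha}$ is the probability measure on $\mathbb N_b$ with $\rho_{b,\alpha;j}=\frac{1}{Z_b(\alpha)}\frac{\alpha^j}{j!}$, where $Z_0(\alpha)=e^\alpha$ and $Z_b(\alpha)=e^\alpha-\sum_{j=0}^{b-1}\alpha^j/j!$ for $b\ge1$. $\alpha_b(c)$ is the unique $\alpha\in(0,\infty)$ for which $\rho_{b,\alpha}$ has mean $c$. Relative entropy: $R(\theta|\rho)=\sum_{j\in\mathbb N_b}\theta_j\log(\theta_j/\rho_j)$ with $0\log0=0$; for a set $A$, $R(A|\rho)=\inf_{\theta\in A}R(\theta|\rho)$ (with $\inf\emptyset=+\infty$). *)

theory Defs
  imports "HOL-Probability.Probability"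
begin

definition admissible :: "real \<Rightarrow> nat set" where
  "admissible c = {N. 2 \<le> N \<and> c * real N \<in> \<int>}"

definition along :: "real \<Rightarrow> nat filter" where
  "along c = inf sequentially (principal (admissible c))"

(* For admissible N and c > 0 this is the integer c N itself; the floor only converts the type. *)
definition particles :: "real \<Rightarrow> nat \<Rightarrow> nat" where
  "particles c N = nat \<lfloor>c * real N\<rfloor>"

definition configs :: "real \<Rightarrow> nat \<Rightarrow> (nat \<Rightarrow> nat) set" where
  "configs c N = {1..particles c N} \<rightarrow>\<^sub>E {1..N}"

definition site_count :: "real \<Rightarrow> nat \<Rightarrow> nat \<Rightarrow> (nat \<Rightarrow> nat) \<Rightarrow> nat" where
  "site_count c N l \<omega> = card {i \<in> {1..particles c N}. \<omega> i = l}"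

definition occ_number :: "real \<Rightarrow> nat \<Rightarrow> nat \<Rightarrow> (nat \<Rightarrow> nat) \<Rightarrow> nat" where
  "occ_number c N j \<omega> = card {l \<in> {1..N}. site_count c N l \<omega> = j}"

definition num_positive :: "nat \<Rightarrow> real \<Rightarrow> nat \<Rightarrow> (nat \<Rightarrow> nat) \<Rightarrow> nat" where
  "num_positive b c N \<omega> = card {j \<in> {b..}. 1 \<le> occ_number c N j \<omega>}"

definition constrained_configs :: "nat \<Rightarrow> real \<Rightarrow> (nat \<Rightarrow> nat) \<Rightarrow> nat \<Rightarrow> (nat \<Rightarrow> nat) set" where
  "constrained_configs b c m N =
     {\<omega> \<in> configs c N. (\<forall>l\<in>{1..N}. b \<le> site_count c N l \<omega>) \<and> num_positive b c N \<omega> \<le> m N}"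

definition uniform_P :: "nat \<Rightarrow> real \<Rightarrow> (nat \<Rightarrow> nat) \<Rightarrow> nat \<Rightarrow> (nat \<Rightarrow> nat) pmf" where
  "uniform_P b c m N = pmf_of_set (constrained_configs b c m N)"

definition number_density :: "real \<Rightarrow> nat \<Rightarrow> (nat \<Rightarrow> nat) \<Rightarrow> nat pmf" where
  "number_density c N \<omega> = embed_pmf (\<lambda>j. real (occ_number c N j \<omega>) / real N)"

lemma pmf_number_density:
  assumes "N > 0"
  shows "pmf (number_density c N \<omega>) j = real (occ_number c N j \<omega>) / real N"
proof -
  let ?f = "\<lambda>j. real (occ_number c N j \<omega>) / real N"
  let ?A = "(\<lambda>l. site_count c N l \<omega>) ` {1..N}"
  have z: "occ_number c N j \<omega> = 0" if "j \<notin> ?A" for j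
    using that by (auto simp: occ_number_def)
  have "(\<Sum>j\<in>?A. occ_number c N j \<omega>) = card (\<Union>j\<in>?A. {l \<in> {1..N}. site_count c N l \<omega> = j})"
    unfolding occ_number_def by (subst card_UN_disjoint) auto
  also have "(\<Union>j\<in>?A. {l \<in> {1..N}. site_count c N l \<omega> = j}) = {1..N}"
    by auto
  finally have s: "(\<Sum>j\<in>?A. occ_number c N j \<omega>) = N" by simp
  have "(\<integral>\<^sup>+j. ennreal (?f j) \<partial>count_space UNIV) = (\<Sum>j\<in>?A. ennreal (?f j))"
    by (rule nn_integral_count_space') (use z in auto)
  also have "\<dots> = ennreal (\<Sum>j\<in>?A. ?f j)"
    by (rule sum_ennreal) auto
  also have "(\<Sum>j\<in>?A. ?f j) = real (\<Sum>j\<in>?A. occ_number c N j \<omega>) / real N"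
    by (simp add: sum_divide_distrib)
  also have "\<dots> = 1" using s assms by simp
  finally have "(\<integral>\<^sup>+j. ennreal (?f j) \<partial>count_space UNIV) = 1" by simp
  then show ?thesis
    unfolding number_density_def by (subst pmf_embed_pmf) auto
qed

definition prob_space_b :: "nat \<Rightarrow> nat pmf set" where
  "prob_space_b b = {\<theta>. set_pmf \<theta> \<subseteq> {b..}}"

(* Integrability is required because the Bochner integral of a non-integrable function is 0. *)
definition prob_mean :: "nat \<Rightarrow> real \<Rightarrow> nat pmf set" where
  "prob_mean b c = {\<theta> \<in> prob_space_b b.
     integrable (measure_pmf \<theta>) real \<and> measure_pmf.expectation \<theta> real = c}"

definition prob_mean_between :: "nat \<Rightarrow> real \<Rightarrow> nat pmf set" where
  "prob_mean_between b c = {\<theta> \<in> prob_space_b b.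
     integrable (measure_pmf \<theta>) real \<and> measure_pmf.expectation \<theta> real \<in> {real b..c}}"

(* The topology of weak convergence: the coarsest one on prob_space_b b that makes
   integration against every bounded continuous function on {b..} continuous. *)
definition weak_topology :: "nat \<Rightarrow> nat pmf topology" where
  "weak_topology b = topology_generated_by
     {{\<theta> \<in> prob_space_b b. measure_pmf.expectation \<theta> f \<in> U} | (f :: nat \<Rightarrow> real) U.
        continuous_on {b..} f \<and> bounded (f ` {b..}) \<and> open U}"

lemma topspace_weak_topology: "topspace (weak_topology b) = prob_space_b b"
proof -
  have "\<exists>(f :: nat \<Rightarrow> real) U. prob_space_b b = {\<theta> \<in> prob_space_b b. measure_pmf.expectation \<theta> f \<in> U} \<and>
          continuous_on {b..} f \<and> bounded (f ` {b..}) \<and> open U"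
    by (rule exI[of _ "\<lambda>_. 0"], rule exI[of _ UNIV]) (auto simp: image_constant_conv)
  then show ?thesis
    unfolding weak_topology_def topology_generated_by_topspace by blast
qed

definition top_mean :: "nat \<Rightarrow> real \<Rightarrow> nat pmf topology" where
  "top_mean b c = subtopology (weak_topology b) (prob_mean b c)"

definition top_mean_between :: "nat \<Rightarrow> real \<Rightarrow> nat pmf topology" where
  "top_mean_between b c = subtopology (weak_topology b) (prob_mean_between b c)"

definition Z_norm :: "nat \<Rightarrow> real \<Rightarrow> real" where
  "Z_norm b \<alpha> = exp \<alpha> - (\<Sum>j<b. \<alpha> ^ j / fact j)"

definition rho :: "nat \<Rightarrow> real \<Rightarrow> nat pmf" where
  "rho b \<alpha> = embed_pmf (\<lambda>j. if b \<le> j then 1 / Z_norm b \<alpha> * (\<alpha> ^ j / fact j) else 0)"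

lemma pmf_rho:
  assumes "\<alpha> > 0"
  shows "pmf (rho b \<alpha>) j = (if b \<le> j then 1 / Z_norm b \<alpha> * (\<alpha> ^ j / fact j) else 0)"
proof -
  let ?g = "\<lambda>j. \<alpha> ^ j / fact j :: real"
  let ?h = "\<lambda>j. if b \<le> j then ?g j else 0"
  let ?f = "\<lambda>j. if b \<le> j then 1 / Z_norm b \<alpha> * ?g j else 0"
  have e: "?g sums exp \<alpha>"
    using exp_converges[of \<alpha>] by (simp add: scaleR_conv_of_real field_simps)
  have l: "(\<lambda>j. if j < b then ?g j else 0) sums (\<Sum>j<b. ?g j)"
    using sums_If_finite_set[of "{..<b}" ?g] by simp
  have "(\<lambda>j. ?g j - (if j < b then ?g j else 0)) sums Z_norm b \<alpha>"
    unfolding Z_norm_def by (rule sums_diff[OF e l])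
  moreover have "(\<lambda>j. ?g j - (if j < b then ?g j else 0)) = ?h" by auto
  ultimately have h: "?h sums Z_norm b \<alpha>" by simp
  have "0 < suminf ?h"
    by (rule suminf_pos2[of _ b]) (use h assms in \<open>auto simp: sums_iff\<close>)
  then have Z: "0 < Z_norm b \<alpha>" using h by (simp add: sums_iff)
  have nn: "0 \<le> ?f j" for j using Z assms by simp
  have "(\<lambda>j. 1 / Z_norm b \<alpha> * ?h j) sums (1 / Z_norm b \<alpha> * Z_norm b \<alpha>)"
    by (rule sums_mult[OF h])
  moreover have "(\<lambda>j. 1 / Z_norm b \<alpha> * ?h j) = ?f" by auto
  ultimately have f: "?f sums 1" using Z by simp
  have "(\<integral>\<^sup>+j. ennreal (?f j) \<partial>count_space UNIV) = (\<Sum>j. ennreal (?f j))"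
    by (rule nn_integral_count_space_nat)
  also have "\<dots> = 1"
    using suminf_ennreal2[OF nn] f by (simp add: sums_iff)
  finally have "(\<integral>\<^sup>+j. ennreal (?f j) \<partial>count_space UNIV) = 1" .
  then show ?thesis
    unfolding rho_def by (subst pmf_embed_pmf) (use nn in auto)
qed

definition alpha :: "nat \<Rightarrow> real \<Rightarrow> real" where
  "alpha b c = (THE \<alpha>. 0 < \<alpha> \<and> rho b \<alpha> \<in> prob_mean b c)"

(* The logarithm with log 0 = -\<infinity>, unlike the real function ln with ln 0 = 0. *)
definition ext_ln :: "ereal \<Rightarrow> ereal" where
  "ext_ln x = (if x \<le> 0 then -\<infinity> else if x = \<infinity> then \<infinity> else ereal (ln (real_of_ereal x)))"

(* In ereal, 0 * (-\<infinity>) = 0, which is the convention 0 log 0 = 0.  The negative part of the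
   series is always summable, so the unordered sum exists in (-\<infinity>, \<infinity>]. *)
definition rel_entropy :: "nat \<Rightarrow> nat pmf \<Rightarrow> nat pmf \<Rightarrow> ereal" where
  "rel_entropy b \<theta> \<rho> =
     (\<Sum>\<^sub>\<infinity>j\<in>{b..}. ereal (pmf \<theta> j) * ext_ln (ereal (pmf \<theta> j) / ereal (pmf \<rho> j)))"

definition rel_entropy_set :: "nat \<Rightarrow> nat pmf set \<Rightarrow> nat pmf \<Rightarrow> ereal" where
  "rel_entropy_set b A \<rho> = (INF \<theta>\<in>A. rel_entropy b \<theta> \<rho>)"

definition log_rate :: "nat \<Rightarrow> real \<Rightarrow> (nat \<Rightarrow> nat) \<Rightarrow> nat pmf set \<Rightarrow> nat \<Rightarrow> ereal" where
  "log_rate b c m A N = ereal (1 / real N) *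
     ext_ln (ereal (measure_pmf.prob (uniform_P b c m N) {\<omega>. number_density c N \<omega> \<in> A}))"

end

theory Submission
  imports Defs "HOL-Real_Asymp.Real_Asymp"
begin

text \<open>
  Configurations are grouped by their type, the multiset \<open>\<nu>\<close> of the \<open>N\<close> occupation numbers.
  A type class has exactly \<open>N! / \<Prod>\<^sub>j N\<^sub>j! \<cdot> K! / \<Prod>\<^sub>j (j!)\<^bsup>N\<^sub>j\<^esup>\<close> elements, and by elementary bounds on
  factorials its logarithm is \<open>N ln Z\<^sub>b(\<alpha>) - K ln \<alpha> + ln K! - N R(\<nu>/N | \<rho>)\<close> up to an error
  \<open>O(m ln N)\<close>.  There are at most \<open>((K+1)(N+1))\<^sup>m\<close> types, and both errors are \<open>o(N)\<close> because
  \<open>m\<^sup>2/N \<rightarrow> 0\<close>.  Hence the upper bound holds with \<open>R(F | \<rho>)\<close> for every set \<open>F\<close>, without any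
  topology; compact sets are a special case and for closed sets passing to the closure only weakens
  it.  The lower bound needs types close to a given \<open>\<theta>\<close> with nearly the same entropy: mix \<open>\<theta>\<close>
  with \<open>\<rho>\<close> to make \<open>\<theta>\<^sub>b > 0\<close>, truncate, and round, each time repairing total mass and mean at the
  two lowest occupation numbers \<open>b\<close> and \<open>b+1\<close>.
\<close>

subsection \<open>Probability mass functions on the naturals\<close>

text \<open>The counting estimate holds for every \<alpha> > 0, because \<open>\<alpha> ^ j\<close>
  contributes only through the sum of the occupation numbers, which is the constant K. The value
  \<open>alpha b c\<close> matters because \<open>\<rho>\<close> then has mean c itself, so the
  smallest entropy in the space is 0, attained at \<open>\<rho>\<close>. The lower bound applied at
  \<open>\<rho>\<close> thus determines the normalising constant, and the type-independent terms
  cancel in every probability. The obstacle is that the measures of mean exactly c are not closed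
  under weak limits: a little mass at large j can carry away part of the mean. Hence compactness of
  the level sets rests on the exponential moments of \<open>\<rho>\<close>, and every approximant in
  the lower bound must have mean exactly c. Since relative entropy is only lower semicontinuous, the
  approximants need explicit control of their entropy as well.\<close>

lemma pmf_nat_sums_1: "pmf \<theta> sums 1" for \<theta> :: "nat pmf"
proof -
  have "integrable (count_space UNIV) (pmf \<theta>)" by (rule integrable_pmf)
  then have "pmf \<theta> sums (\<integral>j. pmf \<theta> j \<partial>count_space UNIV)"
    by (rule sums_integral_count_space_nat)
  moreover have "(\<integral>j. pmf \<theta> j \<partial>count_space UNIV) = 1"
    by (simp add: integral_pmf)
  ultimately show ?thesis by simp
qed

lemma pmf_embed_pmf_nat:
  fixes p :: "nat \<Rightarrow> real"
  assumes "\<And>j. 0 \<le> p j" "p sums 1"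
  shows "pmf (embed_pmf p) j = p j"
proof -
  have "(\<integral>\<^sup>+j. ennreal (p j) \<partial>count_space UNIV) = (\<Sum>j. ennreal (p j))"
    by (rule nn_integral_count_space_nat)
  also have "\<dots> = 1"
    using suminf_ennreal2[OF assms(1) sums_summable[OF assms(2)]] sums_unique[OF assms(2)] by simp
  finally show ?thesis by (subst pmf_embed_pmf) (use assms in auto)
qed

lemma integrable_pmf_nat_iff:
  fixes f :: "nat \<Rightarrow> real"
  shows "integrable (measure_pmf \<theta>) f \<longleftrightarrow> summable (\<lambda>j. \<bar>pmf \<theta> j * f j\<bar>)"
  unfolding measure_pmf_eq_density
  by (subst integrable_density) (auto simp: integrable_count_space_nat_iff)

lemma expectation_pmf_nat_sums:
  fixes f :: "nat \<Rightarrow> real"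
  assumes "integrable (measure_pmf \<theta>) f"
  shows "(\<lambda>j. pmf \<theta> j * f j) sums measure_pmf.expectation \<theta> f"
proof -
  have "integrable (count_space UNIV) (\<lambda>j. pmf \<theta> j * f j)"
    using assms by (simp add: integrable_pmf_nat_iff integrable_count_space_nat_iff)
  then have "(\<lambda>j. pmf \<theta> j * f j) sums (\<integral>j. pmf \<theta> j * f j \<partial>count_space UNIV)"
    by (rule sums_integral_count_space_nat)
  then show ?thesis
    unfolding measure_pmf_eq_density by (subst integral_density) auto
qed

lemma prob_space_b_iff: "\<theta> \<in> prob_space_b b \<longleftrightarrow> (\<forall>j<b. pmf \<theta> j = 0)"
proof -
  have "set_pmf \<theta> \<subseteq> {b..} \<longleftrightarrow> (\<forall>j. j < b \<longrightarrow> j \<notin> set_pmf \<theta>)"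
    by (auto simp: subset_eq not_le[symmetric])
  then show ?thesis by (simp add: prob_space_b_def set_pmf_iff)
qed

text \<open>The terms are nonnegative, so integrability is summability; means are handled as series
  from here on.\<close>

lemma prob_mean_iff:
  "\<theta> \<in> prob_mean b c \<longleftrightarrow> \<theta> \<in> prob_space_b b \<and> (\<lambda>j. pmf \<theta> j * real j) sums c"
proof -
  have "integrable (measure_pmf \<theta>) real \<longleftrightarrow> summable (\<lambda>j. pmf \<theta> j * real j)"
    by (simp add: integrable_pmf_nat_iff abs_mult)
  then show ?thesis
    using expectation_pmf_nat_sums[of \<theta> real] by (auto simp: prob_mean_def sums_iff)
qed

text \<open>Since the total mass is 1, the tail error is expressed by finitely many coordinates, so
  the bound survives pointwise limits.\<close>

lemma expectation_pmf_nat_truncation: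
  fixes f :: "nat \<Rightarrow> real"
  assumes B: "\<And>j. \<bar>f j\<bar> \<le> B"
  shows "\<bar>measure_pmf.expectation \<theta> f - (\<Sum>j<n. pmf \<theta> j * f j)\<bar> \<le> B * (1 - (\<Sum>j<n. pmf \<theta> j))"
proof -
  have int: "integrable (measure_pmf \<theta>) f"
    by (rule measure_pmf.integrable_const_bound[of _ B]) (use B in auto)
  have s: "(\<lambda>j. pmf \<theta> (j + n) * f (j + n)) sums (measure_pmf.expectation \<theta> f - (\<Sum>j<n. pmf \<theta> j * f j))"
    using expectation_pmf_nat_sums[OF int] by (subst sums_iff_shift) simp
  have t: "(\<lambda>j. B * pmf \<theta> (j + n)) sums (B * (1 - (\<Sum>j<n. pmf \<theta> j)))"
    using pmf_nat_sums_1[of \<theta>] by (intro sums_mult, subst sums_iff_shift) simp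
  have le: "\<bar>pmf \<theta> j * f j\<bar> \<le> B * pmf \<theta> j" for j
    using mult_left_mono[OF B[of j] pmf_nonneg[of \<theta> j]] by (simp add: abs_mult mult.commute)
  have "measure_pmf.expectation \<theta> f - (\<Sum>j<n. pmf \<theta> j * f j) \<le> B * (1 - (\<Sum>j<n. pmf \<theta> j))"
    by (rule sums_le[OF _ s t]) (use le in \<open>auto simp: abs_le_iff\<close>)
  moreover have "- (measure_pmf.expectation \<theta> f - (\<Sum>j<n. pmf \<theta> j * f j)) \<le> B * (1 - (\<Sum>j<n. pmf \<theta> j))"
    by (rule sums_le[OF _ sums_minus[OF s] t]) (use le in \<open>auto simp: abs_le_iff\<close>)
  ultimately show ?thesis by (simp add: abs_le_iff)
qed

text \<open>A form of Scheffe's lemma: because the limit is again a probability measure, pointwise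
  convergence leaves no room for mass to escape.\<close>

lemma tendsto_expectation_pmf_nat:
  fixes f :: "nat \<Rightarrow> real" and X :: "'i \<Rightarrow> nat pmf"
  assumes B: "\<And>j. \<bar>f j\<bar> \<le> B"
    and X: "\<And>j. ((\<lambda>i. pmf (X i) j) \<longlongrightarrow> pmf \<theta> j) F"
  shows "((\<lambda>i. measure_pmf.expectation (X i) f) \<longlongrightarrow> measure_pmf.expectation \<theta> f) F"
proof (rule tendstoI)
  fix e :: real assume e: "e > 0"
  have "(\<lambda>n. B * (1 - (\<Sum>j<n. pmf \<theta> j))) \<longlonglongrightarrow> B * (1 - 1)"
    using pmf_nat_sums_1[of \<theta>] unfolding sums_def by (intro tendsto_intros)
  then have "eventually (\<lambda>n. B * (1 - (\<Sum>j<n. pmf \<theta> j)) < e / 3) sequentially"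
    using e by (intro order_tendstoD(2)) auto
  then obtain n where n: "B * (1 - (\<Sum>j<n. pmf \<theta> j)) < e / 3"
    by (auto dest: eventually_happens)
  have "((\<lambda>i. B * (1 - (\<Sum>j<n. pmf (X i) j))) \<longlongrightarrow> B * (1 - (\<Sum>j<n. pmf \<theta> j))) F"
    by (intro tendsto_intros X)
  then have 1: "eventually (\<lambda>i. B * (1 - (\<Sum>j<n. pmf (X i) j)) < e / 3) F"
    using n by (rule order_tendstoD(2))
  have "((\<lambda>i. \<Sum>j<n. pmf (X i) j * f j) \<longlongrightarrow> (\<Sum>j<n. pmf \<theta> j * f j)) F"
    by (intro tendsto_intros X)
  then have 2: "eventually (\<lambda>i. dist (\<Sum>j<n. pmf (X i) j * f j) (\<Sum>j<n. pmf \<theta> j * f j) < e / 3) F"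
    using e by (intro tendstoD) auto
  from 1 2 show "eventually (\<lambda>i. dist (measure_pmf.expectation (X i) f) (measure_pmf.expectation \<theta> f) < e) F"
  proof eventually_elim
    case (elim i)
    then show ?case
      using expectation_pmf_nat_truncation[of f B "X i" n, OF B]
        expectation_pmf_nat_truncation[of f B \<theta> n, OF B] n
      unfolding dist_real_def by linarith
  qed
qed

section \<open>Weak topology and coordinatewise convergence\<close>

lemma tendsto_expectation_prob_space_b:
  fixes f :: "nat \<Rightarrow> real" and X :: "'i \<Rightarrow> nat pmf"
  assumes bd: "bounded (f ` {b..})" and \<theta>: "\<theta> \<in> prob_space_b b"
    and Xb: "\<And>i. X i \<in> prob_space_b b"
    and X: "\<And>j. ((\<lambda>i. pmf (X i) j) \<longlongrightarrow> pmf \<theta> j) F"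
  shows "((\<lambda>i. measure_pmf.expectation (X i) f) \<longlongrightarrow> measure_pmf.expectation \<theta> f) F"
proof -
  obtain B where B: "\<And>j. j \<ge> b \<Longrightarrow> \<bar>f j\<bar> \<le> B"
    using bd by (auto simp: bounded_iff)
  \<comment> \<open>\<open>f\<close> is bounded only on \<open>{b..}\<close>; the values below b
    carry no mass and may be replaced by 0.\<close>
  define g where "g j = (if b \<le> j then f j else 0)" for j
  have "\<bar>g j\<bar> \<le> B" for j
    using B[of j] B[of b] by (auto simp: g_def)
  from tendsto_expectation_pmf_nat[of g, OF this X]
  have "((\<lambda>i. measure_pmf.expectation (X i) g) \<longlongrightarrow> measure_pmf.expectation \<theta> g) F" .
  moreover have "measure_pmf.expectation \<psi> g = measure_pmf.expectation \<psi> f" if "\<psi> \<in> prob_space_b b" for \<psi>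
    by (rule integral_cong_AE)
      (use that in \<open>auto simp: AE_measure_pmf_iff g_def prob_space_b_def\<close>)
  ultimately show ?thesis using \<theta> Xb by simp
qed

text \<open>Induction over the generation of open sets reduces membership to expectations. Later
  constructions thus have to provide only coordinatewise convergence.\<close>

lemma eventually_in_weak_open:
  fixes X :: "'i \<Rightarrow> nat pmf"
  assumes U: "openin (weak_topology b) U" and \<theta>: "\<theta> \<in> U"
    and Xb: "\<And>i. X i \<in> prob_space_b b"
    and X: "\<And>j. ((\<lambda>i. pmf (X i) j) \<longlongrightarrow> pmf \<theta> j) F"
  shows "eventually (\<lambda>i. X i \<in> U) F"
proof -
  have "generate_topology_on
     {{\<theta> \<in> prob_space_b b. measure_pmf.expectation \<theta> f \<in> U} | (f :: nat \<Rightarrow> real) U.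
        continuous_on {b..} f \<and> bounded (f ` {b..}) \<and> open U} U"
    using U unfolding weak_topology_def by (rule openin_topology_generated_by)
  then show ?thesis using \<theta>
  proof induction
    case Empty
    then show ?case by simp
  next
    case (Int S T)
    then show ?case by (auto intro: eventually_conj)
  next
    case (UN K)
    then obtain S where S: "S \<in> K" "\<theta> \<in> S" by auto
    from UN.IH[OF S] show ?case by eventually_elim (use S in auto)
  next
    case (Basis S)
    then obtain f :: "nat \<Rightarrow> real" and V where
      S: "S = {\<theta> \<in> prob_space_b b. measure_pmf.expectation \<theta> f \<in> V}"
        "bounded (f ` {b..})" "open V" by auto
    have "((\<lambda>i. measure_pmf.expectation (X i) f) \<longlongrightarrow> measure_pmf.expectation \<theta> f) F"
      using Basis(2) S by (intro tendsto_expectation_prob_space_b[OF S(2) _ Xb X]) auto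
    then have "eventually (\<lambda>i. measure_pmf.expectation (X i) f \<in> V) F"
      by (rule topological_tendstoD) (use Basis(2) S in auto)
    then show ?case by eventually_elim (use Xb S in auto)
  qed
qed

lemma eventually_in_top_mean_open:
  fixes X :: "'i \<Rightarrow> nat pmf"
  assumes G: "openin (top_mean b c) G" and \<theta>: "\<theta> \<in> G"
    and Xb: "\<And>i. X i \<in> prob_mean b c"
    and X: "\<And>j. ((\<lambda>i. pmf (X i) j) \<longlongrightarrow> pmf \<theta> j) F"
  shows "eventually (\<lambda>i. X i \<in> G) F"
proof -
  obtain U where U: "openin (weak_topology b) U" "G = U \<inter> prob_mean b c"
    using G by (auto simp: top_mean_def openin_subtopology)
  have "eventually (\<lambda>i. X i \<in> U) F"
    by (rule eventually_in_weak_open[OF U(1) _ _ X]) (use \<theta> U Xb in \<open>auto simp: prob_mean_def\<close>)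
  then show ?thesis by eventually_elim (use U Xb in auto)
qed

text \<open>Carries compactness from the product topology to the weak topology. Every element of
  \<open>L\<close> already has total mass 1, which is what makes \<open>embed_pmf\<close> continuous
  on \<open>L\<close>.\<close>

lemma pmf_compact_image:
  fixes L :: "(nat \<Rightarrow> real) set"
  assumes L: "compact L"
    and nonneg: "\<And>p j. p \<in> L \<Longrightarrow> 0 \<le> p j" and sums: "\<And>p. p \<in> L \<Longrightarrow> p sums 1"
    and mean: "embed_pmf ` L \<subseteq> prob_mean b c"
  shows "compactin (top_mean b c) (embed_pmf ` L)"
proof -
  have pm: "pmf (embed_pmf p) j = p j" if "p \<in> L" for p j
    using pmf_embed_pmf_nat[OF nonneg[OF that] sums[OF that]] .
  have emb: "embed_pmf p \<in> prob_space_b b" if "p \<in> L" for p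
    using mean that by (auto simp: prob_mean_def)
  define S where "S = {{\<theta> \<in> prob_space_b b. measure_pmf.expectation \<theta> f \<in> U} | (f :: nat \<Rightarrow> real) U.
        continuous_on {b..} f \<and> bounded (f ` {b..}) \<and> open U}"
  have weak: "weak_topology b = topology_generated_by S"
    unfolding weak_topology_def S_def ..
  have "continuous_map (top_of_set L) (topology_generated_by S) embed_pmf"
  proof (rule continuous_on_generated_topo)
    fix V assume "V \<in> S"
    then obtain f :: "nat \<Rightarrow> real" and U :: "real set" where
      V: "V = {\<theta> \<in> prob_space_b b. measure_pmf.expectation \<theta> f \<in> U}"
      and f: "continuous_on {b..} f" "bounded (f ` {b..})" "open U"
      unfolding S_def by blast
    have cont: "continuous_on L (\<lambda>p. measure_pmf.expectation (embed_pmf p) f)"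
      unfolding continuous_on_def
    proof
      fix q assume q: "q \<in> L"
      \<comment> \<open>Off \<open>L\<close> the value of \<open>embed_pmf\<close> is uncontrolled;
        a constant there keeps the whole family in \<open>prob_space_b b\<close> without changing
        the limit within \<open>L\<close>.\<close>
      define X where "X p = (if p \<in> L then embed_pmf p else embed_pmf q)" for p
      have Xlim: "((\<lambda>p. pmf (X p) j) \<longlongrightarrow> pmf (embed_pmf q) j) (at q within L)" for j
      proof -
        have "((\<lambda>p. p j) \<longlongrightarrow> q j) (at q within L)"
          using continuous_on_subset[OF continuous_on_product_coordinates[of j]] q
          by (auto simp: continuous_on_def)
        then have "((\<lambda>p. pmf (X p) j) \<longlongrightarrow> q j) (at q within L)"
          by (rule Lim_transform_eventually) (auto simp: eventually_at_filter X_def pm)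
        then show ?thesis by (simp add: pm[OF q])
      qed
      have "((\<lambda>p. measure_pmf.expectation (X p) f) \<longlongrightarrow> measure_pmf.expectation (embed_pmf q) f) (at q within L)"
        by (rule tendsto_expectation_prob_space_b[OF f(2) emb[OF q] _ Xlim])
          (use emb q in \<open>auto simp: X_def\<close>)
      then show "((\<lambda>p. measure_pmf.expectation (embed_pmf p) f) \<longlongrightarrow> measure_pmf.expectation (embed_pmf q) f) (at q within L)"
        by (rule Lim_transform_eventually) (auto simp: eventually_at_filter X_def)
    qed
    have eq: "embed_pmf -` V \<inter> topspace (top_of_set L)
        = L \<inter> (\<lambda>p. measure_pmf.expectation (embed_pmf p) f) -` U"
      using emb by (auto simp: V)
    show "openin (top_of_set L) (embed_pmf -` V \<inter> topspace (top_of_set L))"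
      unfolding eq by (rule continuous_openin_preimage_gen[OF cont f(3)])
  next
    have "\<Union>S = prob_space_b b"
      using topspace_weak_topology[of b] unfolding weak topology_generated_by_topspace .
    then show "embed_pmf ` topspace (top_of_set L) \<subseteq> \<Union>S"
      using emb by (simp add: image_subset_iff)
  qed
  then have "compactin (weak_topology b) (embed_pmf ` L)"
    unfolding weak by (intro image_compactin[of "top_of_set L"]) (use L in \<open>auto simp: compactin_subtopology\<close>)
  then show ?thesis using mean by (simp add: top_mean_def compactin_subtopology)
qed

subsection \<open>Relative entropy and its level sets\<close>

text \<open>The summand \<open>x ln (x/r)\<close> of relative entropy, corrected by \<open>r - x\<close>, which sums to 0 over two
  probability vectors; the corrected terms are nonnegative, so all entropy estimates can be made
  termwise.\<close>

definition entropy_term :: "real \<Rightarrow> real \<Rightarrow> real" where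
  "entropy_term r x = x * ln (x / r) - x + r"

text \<open>Convexity: the left side is the tangent line of \<open>x * ln (x / r)\<close> at z. The
  choices z = r, z = \<open>r * exp y\<close> and z a mixture of x and r give the three estimates
  below.\<close>

lemma x_ln_x_tangent:
  fixes x z r :: real
  assumes "0 \<le> x" "0 < z" "0 < r"
  shows "x * ln (z / r) + x - z \<le> x * ln (x / r)"
proof (cases "x = 0")
  case False
  then have x: "x > 0" using assms by simp
  have "ln (z / x) \<le> z / x - 1" using x assms by (intro ln_le_minus_one) simp
  then have "x * ln (z / x) \<le> z - x"
    using x by (simp add: field_simps)
  moreover have "ln (z / r) = ln (x / r) + ln (z / x)"
    using x assms by (simp add: ln_div)
  ultimately show ?thesis by (simp add: algebra_simps)
qed (use assms in auto)

lemma entropy_term_nonneg: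
  assumes "0 \<le> x" "0 < r"
  shows "0 \<le> entropy_term r x"
  using x_ln_x_tangent[of x r r] assms by (simp add: entropy_term_def)

text \<open>Young's inequality for the conjugate \<open>r * (exp y - 1)\<close>, with
  \<open>- r\<close> discarded. Taking y = t * j will bound tails of the mean by entropy plus an
  exponential moment.\<close>

lemma entropy_term_young:
  assumes "0 \<le> x" "0 < r"
  shows "y * x \<le> entropy_term r x + r * exp y"
  using x_ln_x_tangent[of x "r * exp y" r] assms by (simp add: entropy_term_def algebra_simps)

text \<open>Convexity together with the minimum value 0 at r: moving towards r shrinks the term at
  least by the factor 1 - d.\<close>

lemma entropy_term_mixture:
  assumes x: "0 \<le> x" and r: "0 < r" and d: "0 \<le> d" "d \<le> 1"
  shows "entropy_term r ((1 - d) * x + d * r) \<le> entropy_term r x"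
proof (cases "(1 - d) * x + d * r = 0")
  case True
  then have "d * r = 0" using assms by (simp add: add_nonneg_eq_0_iff)
  then have "d = 0" using r by simp
  then show ?thesis by simp
next
  case False
  define z where "z = (1 - d) * x + d * r"
  have "0 \<le> z" using assms by (auto simp: z_def)
  then have z: "z > 0" using False by (simp add: z_def)
  have 1: "x * ln (z / r) + x - z \<le> x * ln (x / r)" by (rule x_ln_x_tangent[OF x z r])
  have 2: "r * ln (z / r) + r - z \<le> 0" using x_ln_x_tangent[of r z r] z r by simp
  have "(1 - d) * (x * ln (z / r) + x - z) + d * (r * ln (z / r) + r - z) \<le> (1 - d) * (x * ln (x / r)) + d * 0"
    by (intro add_mono mult_left_mono 1 2) (use d in auto)
  also have "(1 - d) * (x * ln (z / r) + x - z) + d * (r * ln (z / r) + r - z) = z * ln (z / r)"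
    by (simp add: z_def algebra_simps)
  finally have "entropy_term r z \<le> (1 - d) * entropy_term r x"
    by (simp add: entropy_term_def z_def algebra_simps)
  also have "\<dots> \<le> 1 * entropy_term r x"
    by (intro mult_right_mono entropy_term_nonneg x r) (use d in auto)
  finally show ?thesis by (simp add: z_def)
qed

lemma continuous_on_x_ln_x: "continuous_on {0..} (\<lambda>x::real. x * ln x)"
  unfolding continuous_on_def
proof
  fix x :: real assume "x \<in> {0..}"
  then consider "x = 0" | "x > 0" by force
  then show "((\<lambda>x. x * ln x) \<longlongrightarrow> x * ln x) (at x within {0..})"
  proof cases
    case 1
    have "((\<lambda>x::real. x * ln x) \<longlongrightarrow> 0) (at_right 0)" by real_asymp
    then show ?thesis using 1 by (simp add: at_within_Ici_at_right)
  next
    case 2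
    then show ?thesis by (intro tendsto_intros) auto
  qed
qed

lemma continuous_on_entropy_term:
  assumes "0 < r"
  shows "continuous_on {0..} (entropy_term r)"
proof -
  have "continuous_on {0..} (\<lambda>x. x * ln x - x * ln r - x + r)"
    by (intro continuous_intros continuous_on_x_ln_x)
  then show ?thesis
    by (rule continuous_on_eq) (use assms in \<open>auto simp: entropy_term_def ln_div algebra_simps\<close>)
qed

section \<open>Relative entropy as a supremum of finite sums\<close>

lemma has_sum_pmf_prob_space_b:
  assumes "\<theta> \<in> prob_space_b b"
  shows "(pmf \<theta> has_sum 1) {b..}"
proof -
  have "(pmf \<theta> has_sum 1) UNIV"
    by (rule sums_nonneg_imp_has_sum[OF pmf_nat_sums_1]) simp
  then show ?thesis
    by (subst has_sum_cong_neutral[of UNIV "{b..}" "pmf \<theta>" "pmf \<theta>"])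
      (use assms in \<open>auto simp: prob_space_b_iff\<close>)
qed

text \<open>Full support on \<open>{b..}\<close> keeps every entropy summand finite. The Poisson
  form of \<open>\<rho>\<close> enters elsewhere, through the counting estimate and the exponential
  moments.\<close>

locale reference_measure =
  fixes b :: nat and \<rho> :: "nat pmf"
  assumes rho_space: "\<rho> \<in> prob_space_b b"
    and rho_pos: "\<And>j. b \<le> j \<Longrightarrow> 0 < pmf \<rho> j"
begin

lemma rel_entropy_integrand:
  assumes "b \<le> j"
  shows "ereal (pmf \<theta> j) * ext_ln (ereal (pmf \<theta> j) / ereal (pmf \<rho> j))
    = ereal (pmf \<theta> j * ln (pmf \<theta> j / pmf \<rho> j))"
proof (cases "pmf \<theta> j = 0")
  case False
  then have "pmf \<theta> j > 0" by (simp add: pmf_pos)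
  then have "0 < pmf \<theta> j / pmf \<rho> j" using rho_pos[OF assms] by simp
  then have "\<not> pmf \<theta> j / pmf \<rho> j \<le> 0" by linarith
  then show ?thesis using rho_pos[OF assms] by (simp add: ext_ln_def)
qed (simp add: zero_ereal_def[symmetric])

lemma entropy_term_pmf_nonneg:
  assumes "\<theta> \<in> prob_space_b b"
  shows "0 \<le> entropy_term (pmf \<rho> j) (pmf \<theta> j)"
proof (cases "b \<le> j")
  case True
  then show ?thesis by (intro entropy_term_nonneg rho_pos) auto
next
  case False
  then show ?thesis using assms rho_space by (simp add: prob_space_b_iff entropy_term_def)
qed

text \<open>Entropy becomes a supremum of functions of finitely many coordinates. This is its lower
  semicontinuity, and it turns an upper bound into countably many closed conditions.\<close>

lemma rel_entropy_eq_SUP: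
  assumes \<theta>: "\<theta> \<in> prob_space_b b"
  shows "rel_entropy b \<theta> \<rho> = (SUP n. ereal (\<Sum>j<n. entropy_term (pmf \<rho> j) (pmf \<theta> j)))"
proof -
  let ?D = "\<lambda>j. entropy_term (pmf \<rho> j) (pmf \<theta> j)"
  let ?h = "\<lambda>j. pmf \<theta> j - pmf \<rho> j"
  let ?g = "\<lambda>j. pmf \<theta> j * ln (pmf \<theta> j / pmf \<rho> j)"
  let ?S = "SUP F\<in>{F. finite F \<and> F \<subseteq> {b..}}. \<Sum>j\<in>F. ereal (?D j)"
  have nn: "0 \<le> ?D j" for j by (rule entropy_term_pmf_nonneg[OF \<theta>])
  have "((\<lambda>j. ereal (?D j)) has_sum ?S) {b..}"
    by (rule nonneg_has_sum_complete) (use nn in auto)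
  then have 1: "((\<lambda>F. \<Sum>j\<in>F. ereal (?D j)) \<longlongrightarrow> ?S) (finite_subsets_at_top {b..})"
    unfolding has_sum_def .
  \<comment> \<open>The correction has unordered sum 0, so putting it back changes nothing. Adding
    the limits is legitimate even if \<open>?S\<close> is infinite, because the other limit is
    finite.\<close>
  have "(?h has_sum (1 - 1)) {b..}"
    unfolding diff_conv_add_uminus
    by (intro has_sum_add has_sum_uminus[THEN iffD2] has_sum_pmf_prob_space_b)
      (simp_all add: has_sum_pmf_prob_space_b \<theta> rho_space)
  then have 2: "((\<lambda>F. ereal (\<Sum>j\<in>F. ?h j)) \<longlongrightarrow> ereal 0) (finite_subsets_at_top {b..})"
    by (simp add: has_sum_def)
  have "((\<lambda>F. (\<Sum>j\<in>F. ereal (?D j)) + ereal (\<Sum>j\<in>F. ?h j)) \<longlongrightarrow> ?S + ereal 0) (finite_subsets_at_top {b..})"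
    by (rule tendsto_add_ereal_general1[OF _ 1 2]) simp
  moreover have "(\<Sum>j\<in>F. ereal (?D j)) + ereal (\<Sum>j\<in>F. ?h j) = (\<Sum>j\<in>F. ereal (?g j))" for F
    by (simp add: sum.distrib[symmetric] entropy_term_def)
  ultimately have "((\<lambda>j. ereal (?g j)) has_sum ?S) {b..}"
    unfolding has_sum_def by (simp only: zero_ereal_def[symmetric] add.right_neutral)
  then have "rel_entropy b \<theta> \<rho> = ?S"
    unfolding rel_entropy_def
    by (subst infsum_cong[OF rel_entropy_integrand]) (auto simp: infsumI)
  also have "?S = (SUP n. ereal (\<Sum>j<n. ?D j))"
  proof (rule antisym)
    show "?S \<le> (SUP n. ereal (\<Sum>j<n. ?D j))"
    proof (rule SUP_least)
      fix F assume F: "F \<in> {F. finite F \<and> F \<subseteq> {b..}}"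
      then obtain n where n: "F \<subseteq> {..<n}"
        using finite_nat_iff_bounded by auto
      have "sum ?D F \<le> (\<Sum>j<n. ?D j)"
        by (rule sum_mono2) (use n nn in auto)
      then show "(\<Sum>j\<in>F. ereal (?D j)) \<le> (SUP n. ereal (\<Sum>j<n. ?D j))"
        by (intro SUP_upper2[of n]) auto
    qed
    show "(SUP n. ereal (\<Sum>j<n. ?D j)) \<le> ?S"
    proof (rule SUP_least)
      fix n
      have "(\<Sum>j<n. ?D j) = (\<Sum>j\<in>{b..<n}. ?D j)"
        by (rule sum.mono_neutral_right)
          (use \<theta> rho_space in \<open>auto simp: prob_space_b_iff entropy_term_def\<close>)
      then show "ereal (\<Sum>j<n. ?D j) \<le> ?S"
        by (intro SUP_upper2[of "{b..<n}"]) auto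
    qed
  qed
  finally show ?thesis .
qed

lemma rel_entropy_le_iff:
  assumes "\<theta> \<in> prob_space_b b"
  shows "rel_entropy b \<theta> \<rho> \<le> ereal M \<longleftrightarrow> (\<forall>n. (\<Sum>j<n. entropy_term (pmf \<rho> j) (pmf \<theta> j)) \<le> M)"
  by (simp add: rel_entropy_eq_SUP[OF assms] SUP_le_iff)

lemma rel_entropy_nonneg:
  assumes "\<theta> \<in> prob_space_b b"
  shows "0 \<le> rel_entropy b \<theta> \<rho>"
  unfolding rel_entropy_eq_SUP[OF assms] by (rule SUP_upper2[of 0]) auto

lemma rel_entropy_self: "rel_entropy b \<rho> \<rho> = 0"
proof -
  have z: "entropy_term (pmf \<rho> j) (pmf \<rho> j) = 0" for j
    by (cases "pmf \<rho> j = 0") (auto simp: entropy_term_def)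
  show ?thesis unfolding rel_entropy_eq_SUP[OF rho_space] by (simp add: z zero_ereal_def)
qed

lemma rel_entropy_finite_support:
  assumes \<theta>: "\<theta> \<in> prob_space_b b" and n: "\<And>j. n \<le> j \<Longrightarrow> pmf \<theta> j = 0"
  shows "rel_entropy b \<theta> \<rho> = ereal (\<Sum>j<n. pmf \<theta> j * ln (pmf \<theta> j / pmf \<rho> j))"
proof -
  let ?g = "\<lambda>j. pmf \<theta> j * ln (pmf \<theta> j / pmf \<rho> j)"
  have "rel_entropy b \<theta> \<rho> = (\<Sum>\<^sub>\<infinity>j\<in>{b..<n}. ereal (?g j))"
    unfolding rel_entropy_def
    by (subst infsum_cong[OF rel_entropy_integrand], simp, rule infsum_cong_neutral)
      (use n in \<open>auto simp: zero_ereal_def\<close>)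
  also have "\<dots> = ereal (\<Sum>j\<in>{b..<n}. ?g j)" by simp
  also have "(\<Sum>j\<in>{b..<n}. ?g j) = (\<Sum>j<n. ?g j)"
    by (rule sum.mono_neutral_left) (use \<theta> in \<open>auto simp: prob_space_b_iff\<close>)
  finally show ?thesis .
qed

end

section \<open>Compactness of the level sets\<close>

lemma sums_of_scaled_tail_bound:
  fixes a :: "nat \<Rightarrow> real" and T :: "real \<Rightarrow> nat \<Rightarrow> real"
  assumes a: "\<And>j. 0 \<le> a j" and le: "\<And>n. (\<Sum>j<n. a j) \<le> s"
    and T: "\<And>t. 0 < t \<Longrightarrow> T t \<longlonglongrightarrow> 0"
    and tail: "\<And>t n. 0 < t \<Longrightarrow> 0 < n \<Longrightarrow> t * (s - (\<Sum>j<n. a j)) \<le> M + T t n"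
  shows "a sums s"
  unfolding sums_def
proof (rule LIMSEQ_I)
  fix e :: real assume e: "e > 0"
  \<comment> \<open>With t fixed first and n large enough for \<open>T t n < 1\<close>, division by
    t leaves a tail of at most e / 2. The absolute value keeps t positive when M is
    negative.\<close>
  define t where "t = (\<bar>M\<bar> + 1) * 2 / e"
  have l: "t > 0" using e by (auto simp: t_def intro!: divide_pos_pos)
  have "eventually (\<lambda>n. T t n < 1 \<and> 0 < n) sequentially"
    using order_tendstoD(2)[OF T[OF l], of 1] eventually_gt_at_top[of 0]
    by (auto intro: eventually_conj)
  then obtain n0 where n0: "\<And>n. n \<ge> n0 \<Longrightarrow> T t n < 1 \<and> 0 < n"
    by (auto simp: eventually_sequentially)
  show "\<exists>no. \<forall>n\<ge>no. norm ((\<Sum>j<n. a j) - s) < e"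
  proof (intro exI allI impI)
    fix n assume "n \<ge> n0"
    then have "t * (s - (\<Sum>j<n. a j)) \<le> \<bar>M\<bar> + 1"
      using tail[OF l, of n] n0[of n] by auto
    also have "\<dots> = t * (e / 2)" using e by (simp add: t_def)
    finally have "s - (\<Sum>j<n. a j) \<le> e / 2" using l by simp
    then show "norm ((\<Sum>j<n. a j) - s) < e" using le[of n] e by simp
  qed
qed

lemma compact_unit_cube: "compact {p :: nat \<Rightarrow> real. \<forall>j. 0 \<le> p j \<and> p j \<le> 1}"
proof -
  have "compactin (product_topology (\<lambda>_::nat. euclidean :: real topology) UNIV) (PiE UNIV (\<lambda>_. {0..1}))"
    by (subst compactin_PiE) (auto simp: compactin_euclidean_iff)
  then have "compact (PiE UNIV (\<lambda>_::nat. {0..1::real}))"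
    unfolding euclidean_product_topology compactin_euclidean_iff .
  also have "PiE UNIV (\<lambda>_::nat. {0..1::real}) = {p. \<forall>j. 0 \<le> p j \<and> p j \<le> 1}"
    by (auto simp: PiE_def)
  finally show ?thesis .
qed

context reference_measure
begin

text \<open>Along a weak limit the mean could still drop below c. Finite exponential moments of
  every order exclude this: the tail of the mean is at most \<open>(M + T t n) / t\<close>,
  uniformly over the level set, and t is arbitrary.\<close>

lemma compactin_level_set:
  assumes expm: "\<And>t. summable (\<lambda>j. pmf \<rho> j * exp (t * real j))"
  shows "compactin (top_mean b c) {\<theta> \<in> prob_mean b c. rel_entropy b \<theta> \<rho> \<le> ereal M}"
proof -
  define f where "f t j = pmf \<rho> j * exp (t * real j)" for t j
  define T where "T t n = suminf (f t) - (\<Sum>j<n. f t j)" for t n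
  have fs: "summable (f t)" for t using expm[of t] by (simp add: f_def[abs_def])
  have f0: "0 \<le> f t j" for t j by (simp add: f_def)
  have T0: "T t \<longlonglongrightarrow> 0" for t
  proof -
    have "T t \<longlonglongrightarrow> suminf (f t) - suminf (f t)"
      unfolding T_def by (intro tendsto_intros summable_LIMSEQ fs)
    then show ?thesis by simp
  qed
  let ?D = "\<lambda>p j. entropy_term (pmf \<rho> j) \<bar>p j\<bar>"
  \<comment> \<open>The last two conditions, which come from Young's inequality applied to \<open>t * j * p j\<close>, prevent
    the escape of mass and mean.  All conditions involve finitely many coordinates, so \<open>L\<close> is closed
    in the product topology; \<open>\<bar>p j\<bar>\<close> serves to make the entropy terms continuous everywhere.\<close>
  define L where "L = {p :: nat \<Rightarrow> real. (\<forall>j. 0 \<le> p j) \<and> (\<forall>j. j < b \<longrightarrow> p j \<le> 0) \<and>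
     (\<forall>n. (\<Sum>j<n. p j) \<le> 1) \<and> (\<forall>n. (\<Sum>j<n. p j * real j) \<le> c) \<and>
     (\<forall>n. (\<Sum>j\<in>{b..<n}. ?D p j) \<le> M) \<and>
     (\<forall>t n. 0 < t \<longrightarrow> 0 < n \<longrightarrow> t * (1 - (\<Sum>j<n. p j)) \<le> M + T t n) \<and>
     (\<forall>t n. 0 < t \<longrightarrow> 0 < n \<longrightarrow> t * (c - (\<Sum>j<n. p j * real j)) \<le> M + T t n)}"
  have contD: "continuous_on UNIV (\<lambda>p. ?D p j)" if "b \<le> j" for j
    by (rule continuous_on_compose2[OF continuous_on_entropy_term[OF rho_pos[OF that]]])
      (auto intro!: continuous_intros)
  have closed: "closed L"
    unfolding L_def
    by (intro closed_Collect_conj closed_Collect_all closed_Collect_imp closed_Collect_le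
          open_Collect_const continuous_intros contD) auto
  \<comment> \<open>Each coordinate is dominated by the total mass, so \<open>L\<close> is a closed
    subset of a compact cube.\<close>
  have "L \<subseteq> {p. \<forall>j. 0 \<le> p j \<and> p j \<le> 1}"
  proof safe
    fix p j assume p: "p \<in> L"
    then show "0 \<le> p j" by (simp add: L_def)
    have "p j = (\<Sum>i\<in>{j}. p i)" by simp
    also have "\<dots> \<le> (\<Sum>i<Suc j. p i)" by (rule sum_mono2) (use p in \<open>auto simp: L_def\<close>)
    also have "\<dots> \<le> 1" using p unfolding L_def by blast
    finally show "p j \<le> 1" .
  qed
  then have "compact L"
    using compact_Int_closed[OF compact_unit_cube closed] by (simp add: Int_absorb1)
  moreover have nonneg: "0 \<le> p j" if "p \<in> L" for p j using that by (simp add: L_def)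
  moreover have sums1: "p sums 1" if "p \<in> L" for p
    by (rule sums_of_scaled_tail_bound[where T = T and M = M]) (use that T0 in \<open>auto simp: L_def\<close>)
  moreover have img: "embed_pmf ` L = {\<theta> \<in> prob_mean b c. rel_entropy b \<theta> \<rho> \<le> ereal M}"
  proof (intro equalityI subsetI)
    fix \<theta> assume "\<theta> \<in> embed_pmf ` L"
    then obtain p where p: "p \<in> L" "\<theta> = embed_pmf p" by auto
    have pm: "pmf \<theta> j = p j" for j
      unfolding p(2) by (rule pmf_embed_pmf_nat[OF nonneg[OF p(1)] sums1[OF p(1)]])
    have "p j = 0" if "j < b" for j
      using p(1) that by (auto simp: L_def intro: antisym)
    then have sp: "\<theta> \<in> prob_space_b b" by (simp add: prob_space_b_iff pm)
    have "(\<lambda>j. p j * real j) sums c"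
      by (rule sums_of_scaled_tail_bound[where T = T and M = M]) (use p T0 in \<open>auto simp: L_def\<close>)
    then have mn: "\<theta> \<in> prob_mean b c" using sp by (simp add: prob_mean_iff pm)
    have "(\<Sum>j<n. entropy_term (pmf \<rho> j) (pmf \<theta> j)) \<le> M" for n
    proof -
      have "(\<Sum>j<n. entropy_term (pmf \<rho> j) (pmf \<theta> j)) = (\<Sum>j\<in>{b..<n}. entropy_term (pmf \<rho> j) (pmf \<theta> j))"
        by (rule sum.mono_neutral_right)
          (use sp rho_space in \<open>auto simp: prob_space_b_iff entropy_term_def\<close>)
      also have "\<dots> = (\<Sum>j\<in>{b..<n}. ?D p j)"
        using nonneg[OF p(1)] by (simp add: pm)
      also have "\<dots> \<le> M" using p(1) unfolding L_def by blast
      finally show ?thesis .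
    qed
    then show "\<theta> \<in> {\<theta> \<in> prob_mean b c. rel_entropy b \<theta> \<rho> \<le> ereal M}"
      using mn sp by (simp add: rel_entropy_le_iff)
  next
    fix \<theta> assume "\<theta> \<in> {\<theta> \<in> prob_mean b c. rel_entropy b \<theta> \<rho> \<le> ereal M}"
    then have sp: "\<theta> \<in> prob_space_b b" and mn: "(\<lambda>j. pmf \<theta> j * real j) sums c"
      and M: "\<And>n. (\<Sum>j<n. entropy_term (pmf \<rho> j) (pmf \<theta> j)) \<le> M"
      by (auto simp: prob_mean_iff rel_entropy_le_iff)
    have D0: "0 \<le> entropy_term (pmf \<rho> j) (pmf \<theta> j)" for j by (rule entropy_term_pmf_nonneg[OF sp])
    have young: "t * (pmf \<theta> j * real j) \<le> entropy_term (pmf \<rho> j) (pmf \<theta> j) + f t j" for t j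
    proof (cases "b \<le> j")
      case True
      from entropy_term_young[OF pmf_nonneg rho_pos[OF this], of "t * real j" \<theta> j]
      show ?thesis by (simp add: f_def mult_ac)
    next
      case False
      then show ?thesis using sp D0[of j] f0[of t j] by (simp add: prob_space_b_iff)
    qed
    \<comment> \<open>The tail is a limit of finite blocks \<open>{n..<k}\<close>. On a block,
      Young's inequality leaves entropy of at most M and a block of the convergent moment
      series.\<close>
    have tailc: "t * (c - (\<Sum>j<n. pmf \<theta> j * real j)) \<le> M + T t n" if "0 < t" for t n
    proof (rule LIMSEQ_le_const2)
      show "(\<lambda>k. t * ((\<Sum>j<k. pmf \<theta> j * real j) - (\<Sum>j<n. pmf \<theta> j * real j))) \<longlonglongrightarrow> t * (c - (\<Sum>j<n. pmf \<theta> j * real j))"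
        using mn by (intro tendsto_intros) (simp add: sums_def)
      have "t * ((\<Sum>j<k. pmf \<theta> j * real j) - (\<Sum>j<n. pmf \<theta> j * real j)) \<le> M + T t n" if "k \<ge> n" for k
      proof -
        have split: "(\<Sum>j<k. g j) = (\<Sum>j<n. g j) + (\<Sum>j\<in>{n..<k}. g j)" for g :: "nat \<Rightarrow> real"
          using sum.atLeastLessThan_concat[of 0 n k g] that by (simp add: lessThan_atLeast0)
        have "t * ((\<Sum>j<k. pmf \<theta> j * real j) - (\<Sum>j<n. pmf \<theta> j * real j)) = (\<Sum>j\<in>{n..<k}. t * (pmf \<theta> j * real j))"
          by (simp add: split sum_distrib_left)
        also have "\<dots> \<le> (\<Sum>j\<in>{n..<k}. entropy_term (pmf \<rho> j) (pmf \<theta> j) + f t j)"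
          by (intro sum_mono young)
        also have "\<dots> = (\<Sum>j\<in>{n..<k}. entropy_term (pmf \<rho> j) (pmf \<theta> j)) + ((\<Sum>j<k. f t j) - (\<Sum>j<n. f t j))"
          by (simp add: sum.distrib split)
        also have "\<dots> \<le> M + T t n"
          unfolding T_def
        proof (intro add_mono diff_mono order_refl)
          have "(\<Sum>j\<in>{n..<k}. entropy_term (pmf \<rho> j) (pmf \<theta> j)) \<le> (\<Sum>j<k. entropy_term (pmf \<rho> j) (pmf \<theta> j))"
            by (rule sum_mono2) (use D0 in auto)
          also have "\<dots> \<le> M" by (rule M)
          finally show "(\<Sum>j\<in>{n..<k}. entropy_term (pmf \<rho> j) (pmf \<theta> j)) \<le> M" .
          show "(\<Sum>j<k. f t j) \<le> suminf (f t)"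
            by (rule sum_le_suminf[OF fs]) (use f0 in auto)
        qed
        finally show ?thesis .
      qed
      then show "\<exists>N. \<forall>k\<ge>N. t * ((\<Sum>j<k. pmf \<theta> j * real j) - (\<Sum>j<n. pmf \<theta> j * real j)) \<le> M + T t n"
        by blast
    qed
    \<comment> \<open>Here \<open>0 < n\<close> matters: every j in the tail is at least 1, so the
      tail mass is at most the tail of the mean.\<close>
    have tail1: "t * (1 - (\<Sum>j<n. pmf \<theta> j)) \<le> M + T t n" if "0 < t" "0 < n" for t n
    proof -
      have "1 - (\<Sum>j<n. pmf \<theta> j) \<le> c - (\<Sum>j<n. pmf \<theta> j * real j)"
      proof (rule sums_le)
        show "(\<lambda>j. pmf \<theta> (j + n)) sums (1 - (\<Sum>j<n. pmf \<theta> j))"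
          by (subst sums_iff_shift) (simp add: pmf_nat_sums_1)
        show "(\<lambda>j. pmf \<theta> (j + n) * real (j + n)) sums (c - (\<Sum>j<n. pmf \<theta> j * real j))"
          using mn by (subst sums_iff_shift[of "\<lambda>j. pmf \<theta> j * real j"]) simp
        show "pmf \<theta> (j + n) \<le> pmf \<theta> (j + n) * real (j + n)" for j
          using mult_left_mono[of 1 "real (j + n)" "pmf \<theta> (j + n)"] that by simp
      qed
      then have "t * (1 - (\<Sum>j<n. pmf \<theta> j)) \<le> t * (c - (\<Sum>j<n. pmf \<theta> j * real j))"
        using that by simp
      also have "\<dots> \<le> M + T t n" by (rule tailc[OF that(1)])
      finally show ?thesis .
    qed
    have s1: "(\<Sum>j<n. pmf \<theta> j) \<le> 1" for n
      using sum_le_suminf[of "pmf \<theta>" "{..<n}"] pmf_nat_sums_1[of \<theta>] by (simp add: sums_iff)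
    have sc: "(\<Sum>j<n. pmf \<theta> j * real j) \<le> c" for n
      using sum_le_suminf[of "\<lambda>j. pmf \<theta> j * real j" "{..<n}"] mn by (simp add: sums_iff)
    have sD: "(\<Sum>j\<in>{b..<n}. ?D (pmf \<theta>) j) \<le> M" for n
    proof -
      have "(\<Sum>j\<in>{b..<n}. ?D (pmf \<theta>) j) \<le> (\<Sum>j<n. entropy_term (pmf \<rho> j) (pmf \<theta> j))"
        using D0 by (simp, intro sum_mono2) auto
      also have "\<dots> \<le> M" by (rule M)
      finally show ?thesis .
    qed
    have "pmf \<theta> \<in> L"
      using sp s1 sc sD tail1 tailc by (simp add: L_def prob_space_b_iff)
    moreover have "\<theta> = embed_pmf (pmf \<theta>)"
      by (rule pmf_eqI) (simp add: pmf_embed_pmf_nat pmf_nat_sums_1)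
    ultimately show "\<theta> \<in> embed_pmf ` L" by blast
  qed
  ultimately show ?thesis
    using pmf_compact_image[of L b c] by auto
qed

end

subsection \<open>The parameter of the reference measure\<close>

lemma exp_series_sums: "(\<lambda>j. x ^ j / fact j) sums exp (x::real)"
  using exp_converges[of x] by (simp add: scaleR_conv_of_real field_simps)

lemma exp_series_mean_sums: "(\<lambda>j. real j * (x ^ j / fact j)) sums (x * exp (x::real))"
proof -
  have "(\<lambda>j. x * (x ^ j / fact j)) sums (x * exp x)"
    by (intro sums_mult exp_series_sums)
  also have "(\<lambda>j. x * (x ^ j / fact j)) = (\<lambda>j. real (Suc j) * (x ^ Suc j / fact (Suc j)))"
    by (rule ext) (simp add: field_simps del: of_nat_Suc)
  finally show ?thesis by (subst (asm) sums_Suc_iff) simp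
qed

lemma sums_drop_initial:
  fixes f :: "nat \<Rightarrow> real"
  assumes "f sums s"
  shows "(\<lambda>j. if b \<le> j then f j else 0) sums (s - (\<Sum>j<b. f j))"
proof -
  have "(\<lambda>j. f j - (if j \<in> {..<b} then f j else 0)) sums (s - (\<Sum>j<b. f j))"
    by (intro sums_diff assms sums_If_finite_set) simp
  also have "(\<lambda>j. f j - (if j \<in> {..<b} then f j else 0)) = (\<lambda>j. if b \<le> j then f j else 0)"
    by auto
  finally show ?thesis .
qed

lemma Z_norm_sums: "(\<lambda>j. if b \<le> j then \<alpha> ^ j / fact j else 0) sums Z_norm b \<alpha>"
  unfolding Z_norm_def by (intro sums_drop_initial exp_series_sums)

lemma Z_norm_pos:
  assumes "\<alpha> > 0"
  shows "0 < Z_norm b \<alpha>"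
proof -
  have "0 < (\<Sum>j. if b \<le> j then \<alpha> ^ j / fact j else 0)"
    by (rule suminf_pos2[of _ b]) (use assms sums_summable[OF Z_norm_sums] in auto)
  then show ?thesis using sums_unique[OF Z_norm_sums[of b \<alpha>]] by simp
qed

text \<open>For x > 0 this is \<open>Z_norm b x\<close> times the difference between the mean of
  \<open>rho b x\<close> and c. The closed form makes continuity in x evident.\<close>

definition mean_defect :: "nat \<Rightarrow> real \<Rightarrow> real \<Rightarrow> real" where
  "mean_defect b c x = (x - c) * exp x + (\<Sum>j<b. (c - real j) * (x ^ j / fact j))"

lemma mean_defect_sums:
  "(\<lambda>j. if b \<le> j then (real j - c) * (x ^ j / fact j) else 0) sums mean_defect b c x"
proof -
  have "(\<lambda>j. real j * (x ^ j / fact j) - c * (x ^ j / fact j)) sums (x * exp x - c * exp x)"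
    by (intro sums_diff sums_mult exp_series_sums exp_series_mean_sums)
  from sums_drop_initial[OF this, of b]
  have "(\<lambda>j. if b \<le> j then (real j - c) * (x ^ j / fact j) else 0)
      sums (x * exp x - c * exp x - (\<Sum>j<b. (real j - c) * (x ^ j / fact j)))"
    by (simp only: left_diff_distrib)
  also have "x * exp x - c * exp x - (\<Sum>j<b. (real j - c) * (x ^ j / fact j)) = mean_defect b c x"
    unfolding mean_defect_def left_diff_distrib sum_subtractf by simp
  finally show ?thesis .
qed

lemma rho_in_prob_mean_iff:
  assumes "\<alpha> > 0"
  shows "rho b \<alpha> \<in> prob_mean b c \<longleftrightarrow> mean_defect b c \<alpha> = 0"
proof -
  let ?Z = "Z_norm b \<alpha>"
  let ?w = "\<lambda>j. if b \<le> j then \<alpha> ^ j / fact j else 0"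
  have Z: "?Z > 0" by (rule Z_norm_pos[OF assms])
  have sp: "rho b \<alpha> \<in> prob_space_b b" by (simp add: prob_space_b_iff pmf_rho[OF assms])
  have eq: "(\<lambda>j. if b \<le> j then (real j - c) * (\<alpha> ^ j / fact j) else 0)
      = (\<lambda>j. ?Z * (pmf (rho b \<alpha>) j * real j) - c * ?w j)"
    using Z by (auto simp: pmf_rho[OF assms] field_simps)
  have "(\<lambda>j. pmf (rho b \<alpha>) j * real j) sums c \<longleftrightarrow> mean_defect b c \<alpha> = 0"
  proof
    assume "(\<lambda>j. pmf (rho b \<alpha>) j * real j) sums c"
    then have "(\<lambda>j. ?Z * (pmf (rho b \<alpha>) j * real j) - c * ?w j) sums (?Z * c - c * ?Z)"
      by (intro sums_diff sums_mult Z_norm_sums)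
    then show "mean_defect b c \<alpha> = 0"
      using sums_unique2[OF mean_defect_sums[of b c \<alpha>]] unfolding eq by simp
  next
    assume "mean_defect b c \<alpha> = 0"
    then have "(\<lambda>j. ?Z * (pmf (rho b \<alpha>) j * real j) - c * ?w j) sums 0"
      using mean_defect_sums[of b c \<alpha>] unfolding eq by simp
    from sums_add[OF this sums_mult[OF Z_norm_sums[of b \<alpha>], of c]]
    have "(\<lambda>j. ?Z * (pmf (rho b \<alpha>) j * real j)) sums (c * ?Z)" by simp
    from sums_mult[OF this, of "1 / ?Z"] show "(\<lambda>j. pmf (rho b \<alpha>) j * real j) sums c"
      using Z by simp
  qed
  then show ?thesis using sp by (simp add: prob_mean_iff)
qed

text \<open>After division by \<open>x powr c\<close> every term \<open>(j - c) x\<^sup>j / j!\<close> of the defining series is increasing in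
  \<open>x\<close>.\<close>

lemma mean_defect_zero_unique:
  assumes bc: "real b < c" and a: "0 < a" "a < a'"
    and z: "mean_defect b c a = 0" "mean_defect b c a' = 0"
  shows False
proof -
  define u where "u = a' / a"
  have u: "u > 1" using a by (simp add: u_def)
  let ?t = "\<lambda>x j. if b \<le> j then (real j - c) * (x ^ j / fact j) else 0"
  \<comment> \<open>Up to the factor \<open>a' powr c\<close> this is the difference of the two
    series after division by \<open>x powr c\<close>. In each term j - c and the difference of the
    powers of u have the same sign.\<close>
  let ?d = "\<lambda>j. ?t a' j - u powr c * ?t a j"
  have "?d sums (0 - u powr c * 0)"
    using mean_defect_sums[of b c a] mean_defect_sums[of b c a'] unfolding z
    by (intro sums_diff sums_mult)
  then have d: "?d sums 0" by simp
  have eq: "?d j = (real j - c) * (u powr real j - u powr c) * (a ^ j / fact j)" if "b \<le> j" for j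
  proof -
    have "a' ^ j = u ^ j * a ^ j" using a by (simp add: u_def power_divide)
    then show ?thesis using that u by (simp add: powr_realpow algebra_simps diff_divide_distrib)
  qed
  have nn: "0 \<le> ?d j" for j
  proof (cases "b \<le> j")
    case True
    have "0 \<le> (real j - c) * (u powr real j - u powr c)"
    proof (cases "real j \<le> c")
      case True
      then have "u powr real j \<le> u powr c" using u by simp
      then show ?thesis using True by (intro mult_nonpos_nonpos) auto
    next
      case False
      then have "u powr c \<le> u powr real j" using u by simp
      then show ?thesis using False by (intro mult_nonneg_nonneg) auto
    qed
    from mult_nonneg_nonneg[OF this, of "a ^ j / fact j"] show ?thesis
      unfolding eq[OF True] using a by simp
  qed auto
  \<comment> \<open>At j = b both factors are negative, since b < c and u > 1; this makes the sum
    strictly positive.\<close>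
  have "0 < (real b - c) * (u powr real b - u powr c)"
    using u bc by (intro mult_neg_neg) auto
  from mult_pos_pos[OF this, of "a ^ b / fact b"] have "0 < ?d b"
    unfolding eq[OF order_refl] using a by simp
  then have "0 < suminf ?d"
    using d nn by (intro suminf_pos2[of _ b]) (auto simp: sums_iff)
  then show False using d by (simp add: sums_iff)
qed

lemma mean_defect_zero_exists:
  assumes bc: "real b < c"
  shows "\<exists>a>0. mean_defect b c a = 0"
proof -
  \<comment> \<open>The sign near 0 is that of the lowest coefficient \<open>(b - c) / b!\<close>.\<close>
  define f where "f x = (if x = 0 then (real b - c) / fact b else mean_defect b c x / x ^ b)" for x
  define q where "q i = (real (i + b) - c) / fact (i + b)" for i
  have sums: "(\<lambda>i. q i * x ^ i) sums f x" for x
  proof (cases "x = 0")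
    case True
    have "(\<lambda>i. q i * 0 ^ i) sums q 0" by (rule powser_sums_zero)
    then show ?thesis using True by (simp add: f_def q_def)
  next
    case False
    let ?t = "\<lambda>j. if b \<le> j then (real j - c) * (x ^ j / fact j) else 0"
    have "(\<lambda>i. ?t (i + b)) sums (mean_defect b c x - (\<Sum>j<b. ?t j))"
      by (subst sums_iff_shift) (use mean_defect_sums[of b c x] in simp)
    then have "(\<lambda>i. ?t (i + b) / x ^ b) sums (mean_defect b c x / x ^ b)"
      by (intro sums_divide) simp
    then show ?thesis using False by (simp add: f_def q_def power_add)
  qed
  have "(f \<longlongrightarrow> q 0) (at 0)"
    by (rule powser_limit_0[of 1]) (use sums in auto)
  then have "(f \<longlongrightarrow> q 0) (at_right 0)" by (rule tendsto_within_subset) simp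
  moreover have "q 0 < 0" using bc by (simp add: q_def divide_neg_pos)
  ultimately have "eventually (\<lambda>x. f x < 0) (at_right 0)" by (rule order_tendstoD(2))
  moreover have "eventually (\<lambda>x. x < c) (at_right (0::real))"
    using bc by (intro eventually_at_right_less[THEN eventually_mono] order_tendstoD(2)[OF tendsto_ident_at]) auto
  ultimately have "eventually (\<lambda>x. f x < 0 \<and> x < c \<and> 0 < x) (at_right 0)"
    using eventually_at_right_less[of 0] by eventually_elim auto
  then obtain x where x: "f x < 0" "x < c" "0 < x"
    using eventually_happens'[OF trivial_limit_at_right_real] by blast
  then have neg: "mean_defect b c x \<le> 0"
    by (simp add: f_def divide_less_0_iff split: if_splits)
  \<comment> \<open>At x = c the exponential term vanishes, and every remaining coefficient c - j
    with j < b is positive.\<close>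
  have pos: "0 \<le> mean_defect b c c"
    using bc x by (auto simp: mean_defect_def intro!: sum_nonneg mult_nonneg_nonneg)
  have "continuous_on {x..c} (mean_defect b c)"
    unfolding mean_defect_def by (intro continuous_intros) auto
  from IVT'[OF neg pos _ this] x obtain y where "x \<le> y" "mean_defect b c y = 0" by auto
  then show ?thesis using x by (intro exI[of _ y]) auto
qed

lemma alpha_properties:
  assumes "real b < c"
  shows "0 < alpha b c" "rho b (alpha b c) \<in> prob_mean b c"
proof -
  obtain a where a: "0 < a" "mean_defect b c a = 0" using mean_defect_zero_exists[OF assms] by auto
  have "0 < alpha b c \<and> rho b (alpha b c) \<in> prob_mean b c"
    unfolding alpha_def
  proof (rule theI)
    show "0 < a \<and> rho b a \<in> prob_mean b c" using a by (simp add: rho_in_prob_mean_iff)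
    fix a' assume "0 < a' \<and> rho b a' \<in> prob_mean b c"
    then have "0 < a'" "mean_defect b c a' = 0" by (auto simp: rho_in_prob_mean_iff)
    then show "a' = a"
      using mean_defect_zero_unique[OF assms, of a a'] mean_defect_zero_unique[OF assms, of a' a] a
      by (cases a a' rule: linorder_cases) auto
  qed
  then show "0 < alpha b c" "rho b (alpha b c) \<in> prob_mean b c" by auto
qed

lemma reference_measure_rho:
  assumes "0 < \<alpha>"
  shows "reference_measure b (rho b \<alpha>)"
  by unfold_locales (use assms Z_norm_pos[OF assms] in \<open>auto simp: prob_space_b_iff pmf_rho\<close>)

text \<open>Tilting by \<open>exp (t * j)\<close> only changes the Poisson parameter to
  \<open>\<alpha> * exp t\<close>.\<close>

lemma rho_exp_moment_summable:
  assumes "0 < \<alpha>"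
  shows "summable (\<lambda>j. pmf (rho b \<alpha>) j * exp (t * real j))"
proof (rule summable_comparison_test)
  have "summable (\<lambda>j. (\<alpha> * exp t) ^ j / fact j)"
    by (rule sums_summable[OF exp_series_sums])
  then show "summable (\<lambda>j. 1 / Z_norm b \<alpha> * ((\<alpha> * exp t) ^ j / fact j))"
    by (rule summable_mult)
  show "\<exists>N. \<forall>n\<ge>N. norm (pmf (rho b \<alpha>) n * exp (t * real n)) \<le> 1 / Z_norm b \<alpha> * ((\<alpha> * exp t) ^ n / fact n)"
    using assms Z_norm_pos[OF assms, of b]
    by (auto simp: pmf_rho power_mult_distrib exp_of_nat_mult[symmetric] mult_ac)
qed

subsection \<open>Counting configurations of a given type\<close>

text \<open>Read as words of length n, these functions are the arrangements of a multiset. It is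
  used at two levels, for sites carrying occupation numbers and for particles carrying sites. The
  product form avoids division of naturals.\<close>

lemma card_funs_with_image_mset:
  assumes n: "size A = n" and S: "set_mset A \<subseteq> S"
  shows "card {f \<in> {1..n} \<rightarrow>\<^sub>E S. image_mset f (mset_set {1..n}) = A} * (\<Prod>x\<in>set_mset A. fact (count A x)) = fact n"
proof -
  let ?F = "{f \<in> {1..n} \<rightarrow>\<^sub>E S. image_mset f (mset_set {1..n}) = A}"
  have mset: "mset (map f [1..<Suc n]) = image_mset f (mset_set {1..n})" for f
    by (simp only: mset_map mset_upt atLeastLessThanSuc_atLeastAtMost)
  have "bij_betw (\<lambda>f. map f [1..<Suc n]) ?F (permutations_of_multiset A)"
  proof (rule bij_betw_imageI)
    show "inj_on (\<lambda>f. map f [1..<Suc n]) ?F"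
    proof (rule inj_onI)
      fix f g assume fg: "f \<in> ?F" "g \<in> ?F" "map f [1..<Suc n] = map g [1..<Suc n]"
      then have "\<forall>i\<in>{1..n}. f i = g i" by auto
      then show "f = g" using fg by (auto intro: PiE_ext)
    qed
    show "(\<lambda>f. map f [1..<Suc n]) ` ?F = permutations_of_multiset A"
    proof (intro equalityI subsetI)
      fix xs assume "xs \<in> (\<lambda>f. map f [1..<Suc n]) ` ?F"
      then show "xs \<in> permutations_of_multiset A"
        using mset by (auto simp: permutations_of_multiset_def simp del: upt_Suc)
    next
      fix xs assume "xs \<in> permutations_of_multiset A"
      then have xs: "mset xs = A" by (simp add: permutations_of_multiset_def)
      then have len: "length xs = n" using n by (simp flip: size_mset)
      define f where "f i = (if i \<in> {1..n} then xs ! (i - 1) else undefined)" for i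
      have map: "map f [1..<Suc n] = xs"
        by (rule nth_equalityI) (auto simp: len f_def simp del: upt_Suc)
      have "f \<in> {1..n} \<rightarrow>\<^sub>E S"
        using S xs len nth_mem[of _ xs] by (force simp: f_def PiE_iff extensional_def)
      moreover have "image_mset f (mset_set {1..n}) = A"
        using mset[of f] unfolding map xs by (rule sym)
      ultimately show "xs \<in> (\<lambda>f. map f [1..<Suc n]) ` ?F"
        using map by (intro image_eqI[of _ _ f]) auto
    qed
  qed
  then have "card ?F = card (permutations_of_multiset A)" by (rule bij_betw_same_card)
  then show ?thesis using card_permutations_of_multiset_aux[of A] n by simp
qed

definition occ_mset :: "real \<Rightarrow> nat \<Rightarrow> (nat \<Rightarrow> nat) \<Rightarrow> nat multiset" where
  "occ_mset c N \<omega> = image_mset (\<lambda>l. site_count c N l \<omega>) (mset_set {1..N})"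

lemma count_image_mset_set:
  assumes "finite A"
  shows "count (image_mset f (mset_set A)) y = card {x \<in> A. f x = y}"
proof -
  have "count (image_mset f (mset_set A)) y = (\<Sum>x\<in>f -` {y} \<inter> A. 1)"
    unfolding count_image_mset using assms by (intro sum.cong) auto
  also have "f -` {y} \<inter> A = {x \<in> A. f x = y}" by auto
  finally show ?thesis by simp
qed

lemma count_occ_mset: "count (occ_mset c N \<omega>) j = occ_number c N j \<omega>"
  by (simp add: occ_mset_def occ_number_def count_image_mset_set)

lemma size_occ_mset: "size (occ_mset c N \<omega>) = N"
  by (simp add: occ_mset_def)

lemma sum_occ_mset:
  assumes "\<omega> \<in> configs c N"
  shows "sum_mset (occ_mset c N \<omega>) = particles c N"
proof -
  let ?K = "particles c N"
  have "sum_mset (occ_mset c N \<omega>) = (\<Sum>l\<in>{1..N}. card {i \<in> {1..?K}. \<omega> i = l})"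
    by (simp add: occ_mset_def site_count_def sum_unfold_sum_mset)
  also have "\<dots> = card (\<Union>l\<in>{1..N}. {i \<in> {1..?K}. \<omega> i = l})"
    by (subst card_UN_disjoint) auto
  also have "(\<Union>l\<in>{1..N}. {i \<in> {1..?K}. \<omega> i = l}) = {1..?K}"
    using assms by (auto simp: configs_def)
  finally show ?thesis by simp
qed

text \<open>The multinomial coefficient: such a configuration is an arrangement of the multiset that
  contains each site l exactly \<open>\<kappa> l\<close> times.\<close>

lemma card_configs_with_site_counts:
  assumes \<kappa>: "(\<Sum>l\<in>{1..N}. \<kappa> l) = particles c N"
  shows "card {\<omega> \<in> configs c N. \<forall>l\<in>{1..N}. site_count c N l \<omega> = \<kappa> l} * (\<Prod>l\<in>{1..N}. fact (\<kappa> l))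
    = fact (particles c N)"
proof -
  let ?K = "particles c N"
  define A where "A = (\<Sum>l\<in>{1..N}. replicate_mset (\<kappa> l) l)"
  have cnt: "count A l = (if l \<in> {1..N} then \<kappa> l else 0)" for l
    by (simp add: A_def count_sum)
  have size: "size A = ?K" using \<kappa> by (simp add: A_def size_multiset_sum)
  have set: "set_mset A \<subseteq> {1..N}" using cnt by (auto simp: set_mset_def split: if_splits)
  have "{\<omega> \<in> configs c N. \<forall>l\<in>{1..N}. site_count c N l \<omega> = \<kappa> l}
      = {f \<in> {1..?K} \<rightarrow>\<^sub>E {1..N}. image_mset f (mset_set {1..?K}) = A}"
  proof -
    have "(\<forall>l\<in>{1..N}. site_count c N l \<omega> = \<kappa> l) \<longleftrightarrow> image_mset \<omega> (mset_set {1..?K}) = A"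
      if "\<omega> \<in> {1..?K} \<rightarrow>\<^sub>E {1..N}" for \<omega>
    proof -
      have "card {i \<in> {1..?K}. \<omega> i = l} = 0" if "l \<notin> {1..N}" for l
        using that \<open>\<omega> \<in> _\<close> by auto
      then show ?thesis
        unfolding multiset_eq_iff count_image_mset_set[OF finite_atLeastAtMost] cnt site_count_def
        by auto
    qed
    then show ?thesis by (auto simp: configs_def)
  qed
  then have "card {\<omega> \<in> configs c N. \<forall>l\<in>{1..N}. site_count c N l \<omega> = \<kappa> l} * (\<Prod>x\<in>set_mset A. fact (count A x)) = fact ?K"
    using card_funs_with_image_mset[OF size set] by simp
  moreover have "(\<Prod>x\<in>set_mset A. fact (count A x)) = (\<Prod>l\<in>{1..N}. fact (\<kappa> l) :: nat)"
  proof -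
    have "(\<Prod>x\<in>set_mset A. fact (count A x) :: nat) = (\<Prod>x\<in>{1..N}. fact (count A x))"
      by (rule prod.mono_neutral_left) (use set in \<open>auto simp: not_in_iff\<close>)
    also have "\<dots> = (\<Prod>l\<in>{1..N}. fact (\<kappa> l))" by (rule prod.cong) (auto simp: cnt)
    finally show ?thesis .
  qed
  ultimately show ?thesis by simp
qed

definition occ_class :: "real \<Rightarrow> nat \<Rightarrow> nat multiset \<Rightarrow> (nat \<Rightarrow> nat) set" where
  "occ_class c N \<nu> = {\<omega> \<in> configs c N. occ_mset c N \<omega> = \<nu>}"

lemma finite_configs [simp]: "finite (configs c N)"
  by (simp add: configs_def finite_PiE)

text \<open>Choose the vector of site counts, then the configuration realising it. The second number
  is the same for every vector, because the product of the factorials of its entries depends only on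
  \<open>\<nu>\<close>.\<close>

lemma card_occ_class:
  assumes size: "size \<nu> = N" and sum: "sum_mset \<nu> = particles c N"
  shows "card (occ_class c N \<nu>) * prod_mset (image_mset fact \<nu>) * (\<Prod>j\<in>set_mset \<nu>. fact (count \<nu> j))
    = fact N * fact (particles c N)"
proof -
  let ?K = "particles c N"
  let ?P = "prod_mset (image_mset fact \<nu>) :: nat"
  define \<Phi> where "\<Phi> = {f \<in> {1..N} \<rightarrow>\<^sub>E UNIV. image_mset f (mset_set {1..N}) = \<nu>}"
  define C where "C \<kappa> = {\<omega> \<in> configs c N. \<forall>l\<in>{1..N}. site_count c N l \<omega> = \<kappa> l}" for \<kappa>
  have card\<Phi>: "card \<Phi> * (\<Prod>j\<in>set_mset \<nu>. fact (count \<nu> j)) = fact N"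
    unfolding \<Phi>_def by (rule card_funs_with_image_mset[OF size]) simp
  have "(\<Prod>j\<in>set_mset \<nu>. fact (count \<nu> j) :: nat) > 0" by (intro prod_pos) auto
  \<comment> \<open>The \<open>card\<close> of an infinite set is 0, so the counting identity itself
    forces finiteness, although the codomain is infinite.\<close>
  then have fin: "finite \<Phi>"
    using card\<Phi> by (metis card.infinite fact_nonzero mult_0)
  have C: "card (C \<kappa>) * ?P = fact ?K" if "\<kappa> \<in> \<Phi>" for \<kappa>
  proof -
    have \<nu>: "\<nu> = image_mset \<kappa> (mset_set {1..N})" using that by (simp add: \<Phi>_def)
    have "(\<Sum>l\<in>{1..N}. \<kappa> l) = ?K"
      using sum unfolding \<nu> by (simp add: sum_unfold_sum_mset)
    from card_configs_with_site_counts[OF this] show ?thesis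
      unfolding C_def \<nu> by (simp add: prod_unfold_prod_mset image_mset.compositionality o_def)
  qed
  have eq: "occ_class c N \<nu> = (\<Union>\<kappa>\<in>\<Phi>. C \<kappa>)"
  proof (intro equalityI subsetI)
    fix \<omega> assume \<omega>: "\<omega> \<in> occ_class c N \<nu>"
    \<comment> \<open>Restriction makes the vector extensional, as membership in
      \<open>\<Phi>\<close> demands.\<close>
    define \<kappa> where "\<kappa> = restrict (\<lambda>l. site_count c N l \<omega>) {1..N}"
    have "image_mset \<kappa> (mset_set {1..N}) = occ_mset c N \<omega>"
      unfolding occ_mset_def by (rule image_mset_cong) (simp add: \<kappa>_def)
    then have "\<kappa> \<in> \<Phi>" using \<omega> by (auto simp: \<Phi>_def \<kappa>_def occ_class_def)
    moreover have "\<omega> \<in> C \<kappa>" using \<omega> by (auto simp: C_def \<kappa>_def occ_class_def)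
    ultimately show "\<omega> \<in> (\<Union>\<kappa>\<in>\<Phi>. C \<kappa>)" by blast
  next
    fix \<omega> assume "\<omega> \<in> (\<Union>\<kappa>\<in>\<Phi>. C \<kappa>)"
    then obtain \<kappa> where \<kappa>: "\<kappa> \<in> \<Phi>" "\<omega> \<in> C \<kappa>" by blast
    have "occ_mset c N \<omega> = image_mset \<kappa> (mset_set {1..N})"
      unfolding occ_mset_def by (rule image_mset_cong) (use \<kappa> in \<open>simp add: C_def\<close>)
    then show "\<omega> \<in> occ_class c N \<nu>" using \<kappa> by (simp add: occ_class_def \<Phi>_def C_def)
  qed
  have "card (occ_class c N \<nu>) = (\<Sum>\<kappa>\<in>\<Phi>. card (C \<kappa>))"
    unfolding eq
  proof (rule card_UN_disjoint[OF fin])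
    show "\<forall>\<kappa>\<in>\<Phi>. finite (C \<kappa>)" by (auto simp: C_def)
    show "\<forall>\<kappa>\<in>\<Phi>. \<forall>\<kappa>'\<in>\<Phi>. \<kappa> \<noteq> \<kappa>' \<longrightarrow> C \<kappa> \<inter> C \<kappa>' = {}"
    proof (intro ballI impI)
      fix \<kappa> \<kappa>' assume k: "\<kappa> \<in> \<Phi>" "\<kappa>' \<in> \<Phi>" "\<kappa> \<noteq> \<kappa>'"
      have "\<kappa> = \<kappa>'" if "\<omega> \<in> C \<kappa>" "\<omega> \<in> C \<kappa>'" for \<omega>
        by (rule PiE_ext[of _ "{1..N}" "\<lambda>_. UNIV"]) (use k that in \<open>auto simp: \<Phi>_def C_def\<close>)
      then show "C \<kappa> \<inter> C \<kappa>' = {}" using k by blast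
    qed
  qed
  then have "card (occ_class c N \<nu>) * ?P = (\<Sum>\<kappa>\<in>\<Phi>. card (C \<kappa>) * ?P)"
    by (simp add: sum_distrib_right)
  also have "\<dots> = card \<Phi> * fact ?K" using C by simp
  finally show ?thesis using card\<Phi> by (metis mult.assoc mult.commute)
qed

section \<open>Elementary Stirling bounds\<close>

lemma ln_fact_lower: "real n * ln (real n) - real n \<le> ln (fact n)"
proof (induction n)
  case (Suc n)
  have "real n * (ln (real (Suc n)) - ln (real n)) \<le> 1"
  proof (cases "n = 0")
    case False
    then have "ln (real (Suc n) / real n) \<le> real (Suc n) / real n - 1" by (intro ln_le_minus_one) auto
    also have "\<dots> = 1 / real n" using False by (simp add: field_simps)
    finally show ?thesis using False by (simp add: ln_div field_simps)
  qed simp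
  then show ?case using Suc by (simp add: ln_mult algebra_simps del: of_nat_Suc) (simp add: algebra_simps)
qed simp

text \<open>The gap \<open>1 + ln n\<close> to the lower bound, paid once for each distinct
  occupation number, is the source of the error of order m ln N.\<close>

lemma ln_fact_upper:
  assumes "0 < n"
  shows "ln (fact n) \<le> real n * ln (real n) - real n + 1 + ln (real n)"
  using assms
proof (induction n rule: nat_induct_non_zero)
  case (Suc n)
  have "ln (real n / real (Suc n)) \<le> real n / real (Suc n) - 1" using Suc by (intro ln_le_minus_one) auto
  also have "\<dots> = - 1 / real (Suc n)" by (simp add: field_simps)
  finally have "real (Suc n) * (ln (real n) - ln (real (Suc n))) \<le> - 1"
    using Suc by (simp add: ln_div field_simps)
  then show ?case using Suc by (simp add: ln_mult algebra_simps del: of_nat_Suc) (simp add: algebra_simps)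
qed simp


section \<open>Types and their number\<close>

definition occ_types :: "nat \<Rightarrow> real \<Rightarrow> (nat \<Rightarrow> nat) \<Rightarrow> nat \<Rightarrow> nat multiset set" where
  "occ_types b c m N = {\<nu>. size \<nu> = N \<and> sum_mset \<nu> = particles c N \<and>
     (\<forall>j\<in>#\<nu>. b \<le> j) \<and> card (set_mset \<nu>) \<le> m N}"

lemma occ_class_subset_configs: "occ_class c N \<nu> \<subseteq> configs c N"
  by (auto simp: occ_class_def)

lemma finite_occ_class [simp]: "finite (occ_class c N \<nu>)"
  by (rule finite_subset[OF occ_class_subset_configs]) simp

lemma constrained_configs_eq:
  "constrained_configs b c m N = (\<Union>\<nu>\<in>occ_types b c m N. occ_class c N \<nu>)"
proof -
  have "(\<forall>l\<in>{1..N}. b \<le> site_count c N l \<omega>) \<and> num_positive b c N \<omega> \<le> m N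
      \<longleftrightarrow> occ_mset c N \<omega> \<in> occ_types b c m N" if "\<omega> \<in> configs c N" for \<omega>
  proof -
    have b: "(\<forall>l\<in>{1..N}. b \<le> site_count c N l \<omega>) \<longleftrightarrow> (\<forall>j\<in>#occ_mset c N \<omega>. b \<le> j)"
      by (auto simp: occ_mset_def)
    \<comment> \<open>\<open>num_positive\<close> looks only at j \<ge> b, so it is the number of
      distinct elements once all elements are known to be at least b.\<close>
    have "{j \<in> {b..}. 1 \<le> occ_number c N j \<omega>} = set_mset (occ_mset c N \<omega>)"
      if "\<forall>j\<in>#occ_mset c N \<omega>. b \<le> j"
      using that by (auto simp: count_occ_mset[symmetric] Suc_le_eq)
    then show ?thesis
      unfolding b num_positive_def
      by (auto simp: occ_types_def size_occ_mset sum_occ_mset[OF that])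
  qed
  then show ?thesis by (auto simp: constrained_configs_def occ_class_def)
qed

lemma finite_constrained_configs [simp]: "finite (constrained_configs b c m N)"
  by (rule finite_subset[of _ "configs c N"]) (auto simp: constrained_configs_def)

lemma number_density_eq:
  assumes "\<omega> \<in> occ_class c N \<nu>" "0 < N"
  shows "number_density c N \<omega> = pmf_of_multiset \<nu>"
proof (rule pmf_eqI)
  fix j
  have \<nu>: "occ_mset c N \<omega> = \<nu>" using assms by (simp add: occ_class_def)
  have "\<nu> \<noteq> {#}" using size_occ_mset[of c N \<omega>] assms unfolding \<nu> by auto
  then show "pmf (number_density c N \<omega>) j = pmf (pmf_of_multiset \<nu>) j"
    using size_occ_mset[of c N \<omega>] assms count_occ_mset[of c N \<omega> j]
    unfolding \<nu> by (simp add: pmf_number_density)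
qed

text \<open>A type is encoded by its pairs of value and multiplicity. Padding with (0, 0), which
  contributes no element, gives all codes the same length m, so that types are bounded by words of
  length m.\<close>

lemma multiset_from_list:
  fixes \<nu> :: "'a :: {linorder, zero} multiset"
  assumes m: "card (set_mset \<nu>) \<le> m"
  shows "\<exists>xs. length xs = m \<and> set xs \<subseteq> insert (0, 0) ((\<lambda>j. (j, count \<nu> j)) ` set_mset \<nu>) \<and>
    \<nu> = (\<Sum>(j, n)\<leftarrow>xs. replicate_mset n j)"
proof -
  define ys where "ys = sorted_list_of_set (set_mset \<nu>)"
  define xs where "xs = map (\<lambda>j. (j, count \<nu> j)) ys @ replicate (m - card (set_mset \<nu>)) (0, 0)"
  have ys: "set ys = set_mset \<nu>" "distinct ys" "length ys = card (set_mset \<nu>)"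
    by (simp_all add: ys_def)
  have zero: "(\<Sum>(j, n)\<leftarrow>replicate k (0 :: 'a, 0). replicate_mset n j) = {#}" for k
    by (induction k) auto
  have "(\<Sum>(j, n)\<leftarrow>xs. replicate_mset n j) = (\<Sum>j\<leftarrow>ys. replicate_mset (count \<nu> j) j)"
    unfolding xs_def map_append sum_list.append zero by (simp add: o_def)
  also have "\<dots> = (\<Sum>j\<in>set_mset \<nu>. replicate_mset (count \<nu> j) j)"
    using ys by (simp add: sum_list_distinct_conv_sum_set)
  also have "\<dots> = \<nu>"
    by (rule multiset_eqI) (auto simp: count_sum not_in_iff)
  finally show ?thesis
    using m ys by (intro exI[of _ xs]) (auto simp: xs_def)
qed

lemma card_occ_types:
  "finite (occ_types b c m N)"
  "card (occ_types b c m N) \<le> ((particles c N + 1) * (N + 1)) ^ m N"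
proof -
  let ?K = "particles c N"
  \<comment> \<open>No occupation number exceeds the sum K and no multiplicity exceeds the size N;
    both ranges contain 0 for the padding pair.\<close>
  define B where "B = {..?K} \<times> {..N}"
  define X where "X = {xs. set xs \<subseteq> B \<and> length xs = m N}"
  have fin: "finite X" unfolding X_def B_def by (intro finite_lists_length_eq) auto
  have sub: "occ_types b c m N \<subseteq> (\<lambda>xs. \<Sum>(j, n)\<leftarrow>xs. replicate_mset n j) ` X"
  proof
    fix \<nu> assume \<nu>: "\<nu> \<in> occ_types b c m N"
    then obtain xs where xs: "length xs = m N"
      "set xs \<subseteq> insert (0, 0) ((\<lambda>j. (j, count \<nu> j)) ` set_mset \<nu>)"
      "\<nu> = (\<Sum>(j, n)\<leftarrow>xs. replicate_mset n j)"
      using multiset_from_list[of \<nu> "m N"] by (auto simp: occ_types_def)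
    have "j \<le> ?K" if "j \<in># \<nu>" for j
      using \<nu> that by (auto simp: occ_types_def dest: multi_member_split)
    moreover have "count \<nu> j \<le> N" for j
      using \<nu> count_le_size[of \<nu> j] by (simp add: occ_types_def)
    ultimately have "xs \<in> X" using xs(1,2) by (auto simp: X_def B_def)
    then show "\<nu> \<in> (\<lambda>xs. \<Sum>(j, n)\<leftarrow>xs. replicate_mset n j) ` X" using xs(3) by blast
  qed
  show "finite (occ_types b c m N)" using finite_subset[OF sub] fin by blast
  have "card (occ_types b c m N) \<le> card X" by (rule surj_card_le[OF fin sub])
  also have "\<dots> = card B ^ m N" unfolding X_def by (rule card_lists_length_eq) (simp add: B_def)
  finally show "card (occ_types b c m N) \<le> ((?K + 1) * (N + 1)) ^ m N"
    by (simp add: B_def)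
qed

text \<open>The part of the logarithmic class size that is common to all types. It cancels between
  numerator and denominator of a probability, so \<open>fact (particles c N)\<close> can stay
  exact.\<close>

definition log_volume :: "nat \<Rightarrow> real \<Rightarrow> real \<Rightarrow> nat \<Rightarrow> real" where
  "log_volume b \<alpha> c N = real N * ln (Z_norm b \<alpha>) - real (particles c N) * ln \<alpha> + ln (fact (particles c N))"

lemma sum_mset_eq_sum_count:
  fixes f :: "'a \<Rightarrow> real"
  shows "(\<Sum>x\<in>#\<nu>. f x) = (\<Sum>x\<in>set_mset \<nu>. real (count \<nu> x) * f x)"
proof (induction \<nu>)
  case (add y \<nu>)
  have "(\<Sum>x\<in>set_mset (add_mset y \<nu>). real (count (add_mset y \<nu>) x) * f x)
      = (\<Sum>x\<in>insert y (set_mset \<nu>). real (count \<nu> x) * f x + (if x = y then f x else 0))"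
    by (intro sum.cong) (auto simp: algebra_simps)
  also have "\<dots> = (\<Sum>x\<in>insert y (set_mset \<nu>). real (count \<nu> x) * f x) + f y"
    by (simp add: sum.distrib)
  also have "(\<Sum>x\<in>insert y (set_mset \<nu>). real (count \<nu> x) * f x) = (\<Sum>x\<in>set_mset \<nu>. real (count \<nu> x) * f x)"
    by (intro sum.mono_neutral_right) (auto simp: not_in_iff)
  finally show ?case using add by simp
qed simp

lemma ln_prod_mset:
  fixes f :: "'a \<Rightarrow> real"
  assumes "\<And>x. 0 < f x"
  shows "ln (prod_mset (image_mset f \<nu>)) = (\<Sum>x\<in>#\<nu>. ln (f x))"
proof (induction \<nu>)
  case (add y \<nu>)
  have "0 < prod_mset (image_mset f \<nu>)" by (induction \<nu>) (use assms in auto)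
  then have "ln (f y * prod_mset (image_mset f \<nu>)) = ln (f y) + ln (prod_mset (image_mset f \<nu>))"
    by (intro ln_mult_pos assms)
  then show ?case using add by simp
qed simp

lemma pmf_of_multiset_rel_entropy:
  assumes \<alpha>: "0 < \<alpha>" and ne: "\<nu> \<noteq> {#}" and b: "\<forall>j\<in>#\<nu>. b \<le> j"
  shows "rel_entropy b (pmf_of_multiset \<nu>) (rho b \<alpha>) = ereal (\<Sum>j\<in>set_mset \<nu>.
    count \<nu> j / size \<nu> * ln (count \<nu> j / size \<nu> / pmf (rho b \<alpha>) j))"
proof -
  interpret reference_measure b "rho b \<alpha>" by (rule reference_measure_rho[OF \<alpha>])
  obtain n where n: "set_mset \<nu> \<subseteq> {..<n}" using finite_nat_iff_bounded[of "set_mset \<nu>"] by auto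
  have "rel_entropy b (pmf_of_multiset \<nu>) (rho b \<alpha>) = ereal (\<Sum>j<n. pmf (pmf_of_multiset \<nu>) j *
      ln (pmf (pmf_of_multiset \<nu>) j / pmf (rho b \<alpha>) j))"
  proof (rule rel_entropy_finite_support)
    show "pmf_of_multiset \<nu> \<in> prob_space_b b" using b ne by (auto simp: prob_space_b_def)
    show "pmf (pmf_of_multiset \<nu>) j = 0" if "n \<le> j" for j
      using n that ne by (auto simp: not_in_iff[symmetric])
  qed
  also have "(\<Sum>j<n. pmf (pmf_of_multiset \<nu>) j * ln (pmf (pmf_of_multiset \<nu>) j / pmf (rho b \<alpha>) j))
    = (\<Sum>j\<in>set_mset \<nu>. pmf (pmf_of_multiset \<nu>) j * ln (pmf (pmf_of_multiset \<nu>) j / pmf (rho b \<alpha>) j))"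
    by (rule sum.mono_neutral_right) (use n ne in \<open>auto simp: not_in_iff\<close>)
  finally show ?thesis using ne by simp
qed

text \<open>The factors j! of the class size are exactly those in \<open>\<rho>\<close>, and the
  powers of \<alpha> combine to \<open>K * ln \<alpha>\<close> as all types have sum K. Only N! and
  the factorials of the multiplicities are left to be approximated.\<close>

lemma ln_card_occ_class:
  assumes \<alpha>: "0 < \<alpha>" and N: "0 < N" and size: "size \<nu> = N" and sum: "sum_mset \<nu> = particles c N"
    and b: "\<forall>j\<in>#\<nu>. b \<le> j" and d: "card (set_mset \<nu>) \<le> d"
  obtains R where "rel_entropy b (pmf_of_multiset \<nu>) (rho b \<alpha>) = ereal R"
    "0 < card (occ_class c N \<nu>)"
    "\<bar>ln (card (occ_class c N \<nu>)) - (log_volume b \<alpha> c N - real N * R)\<bar> \<le> real d * (1 + ln (real N))"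
proof -
  let ?K = "particles c N"
  let ?S = "set_mset \<nu>"
  let ?n = "\<lambda>j. real (count \<nu> j)"
  define R where "R = (\<Sum>j\<in>?S. ?n j / N * ln (?n j / N / pmf (rho b \<alpha>) j))"
  have ne: "\<nu> \<noteq> {#}" using N size by auto
  have Z: "0 < Z_norm b \<alpha>" by (rule Z_norm_pos[OF \<alpha>])
  have sN: "(\<Sum>j\<in>?S. ?n j) = real N"
    using sum_mset_eq_sum_count[of "\<lambda>_. 1" \<nu>] size by simp
  have sK: "(\<Sum>j\<in>?S. ?n j * real j) = real ?K"
    using sum_mset_eq_sum_count[of real \<nu>] sum by (metis of_nat_sum_mset)
  have nR: "real N * R = (\<Sum>j\<in>?S. ?n j * ln (?n j)) - real N * ln N + real N * ln (Z_norm b \<alpha>)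
      - real ?K * ln \<alpha> + (\<Sum>j\<in>?S. ?n j * ln (fact j))"
  proof -
    have "real N * R = (\<Sum>j\<in>?S. ?n j * ln (?n j / N / pmf (rho b \<alpha>) j))"
      unfolding R_def sum_distrib_left using N by (intro sum.cong) auto
    also have "\<dots> = (\<Sum>j\<in>?S. ?n j * ln (?n j) - ?n j * ln N + ?n j * ln (Z_norm b \<alpha>)
        - ?n j * real j * ln \<alpha> + ?n j * ln (fact j))"
    proof (rule sum.cong[OF refl])
      fix j assume j: "j \<in> ?S"
      then have n: "0 < ?n j" by simp
      have ln_eq: "ln (?n j / N / pmf (rho b \<alpha>) j) = ln (?n j) - ln N + ln (Z_norm b \<alpha>) - real j * ln \<alpha> + ln (fact j)"
        using n N Z \<alpha> b j by (simp add: pmf_rho ln_div ln_mult ln_realpow)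
      then show "?n j * ln (?n j / N / pmf (rho b \<alpha>) j) = ?n j * ln (?n j) - ?n j * ln N + ?n j * ln (Z_norm b \<alpha>)
        - ?n j * real j * ln \<alpha> + ?n j * ln (fact j)"
        unfolding ln_eq by (simp add: algebra_simps)
    qed
    finally show ?thesis
      by (simp add: sum.distrib sum_subtractf sum_distrib_right[symmetric] sN sK)
  qed
  let ?T = "card (occ_class c N \<nu>)"
  have card: "?T * prod_mset (image_mset fact \<nu>) * (\<Prod>j\<in>?S. fact (count \<nu> j)) = fact N * fact ?K"
    by (rule card_occ_class[OF size sum])
  have pos: "0 < ?T" using card by (cases "?T = 0") auto
  have prod_cast: "real (prod_mset (image_mset fact \<nu>)) = prod_mset (image_mset fact \<nu>)"
    by (induction \<nu>) auto
  have "real (?T * prod_mset (image_mset fact \<nu>) * (\<Prod>j\<in>?S. fact (count \<nu> j))) = real (fact N * fact ?K)"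
    unfolding card ..
  then have rcard: "real ?T * prod_mset (image_mset fact \<nu>) * (\<Prod>j\<in>?S. fact (count \<nu> j)) = (fact N * fact ?K :: real)"
    by (simp add: prod_cast)
  have P1: "(0::real) < prod_mset (image_mset fact \<nu>)" by (induction \<nu>) auto
  have P2: "(0::real) < (\<Prod>j\<in>?S. fact (count \<nu> j))" by (intro prod_pos) auto
  have "ln (real ?T) + ln (prod_mset (image_mset fact \<nu>)) + ln (\<Prod>j\<in>?S. fact (count \<nu> j)) = ln (fact N) + ln (fact ?K :: real)"
  proof -
    have "ln (real ?T * prod_mset (image_mset fact \<nu>) * (\<Prod>j\<in>?S. fact (count \<nu> j)))
        = ln (real ?T) + ln (prod_mset (image_mset fact \<nu>)) + ln (\<Prod>j\<in>?S. fact (count \<nu> j))"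
      using pos P1 P2 by (simp only: ln_mult_pos mult_pos_pos of_nat_0_less_iff)
    moreover have "ln (fact N * fact ?K :: real) = ln (fact N) + ln (fact ?K)"
      by (simp add: ln_mult)
    ultimately show ?thesis unfolding rcard by linarith
  qed
  moreover have "ln (prod_mset (image_mset fact \<nu>)) = (\<Sum>j\<in>?S. ?n j * ln (fact j))"
    by (simp add: ln_prod_mset sum_mset_eq_sum_count)
  moreover have "ln (\<Prod>j\<in>?S. fact (count \<nu> j) :: real) = (\<Sum>j\<in>?S. ln (fact (count \<nu> j)))"
    by (rule ln_prod) auto
  \<comment> \<open>The linear Stirling terms may be inserted on both sides because the
    multiplicities sum to N. What remains is a difference of two nonnegative remainders, each within
    the claimed error.\<close>
  ultimately have eq: "ln (real ?T) - (log_volume b \<alpha> c N - real N * R)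
     = (ln (fact N) - real N * ln N + real N) - (\<Sum>j\<in>?S. ln (fact (count \<nu> j)) - ?n j * ln (?n j) + ?n j)"
    unfolding log_volume_def nR by (simp add: sum.distrib sum_subtractf sN)
  have lN: "0 \<le> ln (real N)" using N by simp
  have up: "ln (fact N) - real N * ln N + real N \<le> 1 + ln (real N)" "0 \<le> ln (fact N) - real N * ln N + real N"
    using ln_fact_lower[of N] ln_fact_upper[OF N] by linarith+
  \<comment> \<open>A nonempty multiset has at least one distinct element, so the remainder of N!
    fits into the same bound.\<close>
  have d1: "1 * (1 + ln (real N)) \<le> real d * (1 + ln (real N))"
  proof (intro mult_right_mono)
    have "card ?S \<noteq> 0" using ne by simp
    then show "1 \<le> real d" using d by linarith
  qed (use lN in auto)
  have low: "0 \<le> (\<Sum>j\<in>?S. ln (fact (count \<nu> j)) - ?n j * ln (?n j) + ?n j)"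
    by (intro sum_nonneg) (use ln_fact_lower in \<open>auto simp: algebra_simps\<close>)
  have "(\<Sum>j\<in>?S. ln (fact (count \<nu> j)) - ?n j * ln (?n j) + ?n j) \<le> (\<Sum>j\<in>?S. 1 + ln (real N))"
  proof (intro sum_mono)
    fix j assume "j \<in> ?S"
    then have c: "0 < count \<nu> j" by simp
    then have "0 < ?n j" "?n j \<le> real N" using size count_le_size[of \<nu> j] by linarith+
    then have "ln (?n j) \<le> ln (real N)" by (simp only: ln_le_cancel_iff)
    then show "ln (fact (count \<nu> j)) - ?n j * ln (?n j) + ?n j \<le> 1 + ln (real N)"
      using ln_fact_upper[OF c] by linarith
  qed
  also have "(\<Sum>j\<in>?S. 1 + ln (real N)) \<le> real d * (1 + ln (real N))"
    using d lN by (simp add: mult_right_mono)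
  finally have high: "(\<Sum>j\<in>?S. ln (fact (count \<nu> j)) - ?n j * ln (?n j) + ?n j) \<le> real d * (1 + ln (real N))" .
  have abs_diff: "\<bar>u - s\<bar> \<le> e" if "0 \<le> u" "u \<le> e" "0 \<le> s" "s \<le> e" for u s e :: real
    using that by linarith
  have "\<bar>ln (real ?T) - (log_volume b \<alpha> c N - real N * R)\<bar> \<le> real d * (1 + ln (real N))"
    unfolding eq by (rule abs_diff[OF up(2) order_trans[OF up(1)] low high]) (use d1 in simp)
  moreover have "rel_entropy b (pmf_of_multiset \<nu>) (rho b \<alpha>) = ereal R"
    using pmf_of_multiset_rel_entropy[OF \<alpha> ne b] size by (simp add: R_def)
  ultimately show thesis using pos that by blast
qed

subsection \<open>Approximation by types\<close>

lemma embed_pmf_finite_support: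
  fixes q :: "nat \<Rightarrow> real"
  assumes nonneg: "\<And>j. 0 \<le> q j" and supp: "\<And>j. j < b \<or> n \<le> j \<Longrightarrow> q j = 0"
    and total: "(\<Sum>j<n. q j) = 1" and mean: "(\<Sum>j<n. q j * real j) = c"
  shows "pmf (embed_pmf q) j = q j" "embed_pmf q \<in> prob_mean b c"
proof -
  have s: "q sums 1" "(\<lambda>j. q j * real j) sums c"
    using sums_finite[of "{..<n}" q] sums_finite[of "{..<n}" "\<lambda>j. q j * real j"] supp total mean by auto
  show pm: "pmf (embed_pmf q) j = q j" for j by (rule pmf_embed_pmf_nat[OF nonneg s(1)])
  show "embed_pmf q \<in> prob_mean b c" using s supp by (simp add: prob_mean_iff prob_space_b_iff pm)
qed

lemma prob_mean_finite_support:
  assumes "\<theta> \<in> prob_mean b c" and supp: "\<And>j. n \<le> j \<Longrightarrow> pmf \<theta> j = 0"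
  shows "(\<Sum>j<n. pmf \<theta> j) = 1" "(\<Sum>j<n. pmf \<theta> j * real j) = c"
proof -
  have "pmf \<theta> sums (\<Sum>j<n. pmf \<theta> j)" by (rule sums_finite) (use supp in auto)
  then show "(\<Sum>j<n. pmf \<theta> j) = 1" using pmf_nat_sums_1 by (rule sums_unique2)
  have "(\<lambda>j. pmf \<theta> j * real j) sums (\<Sum>j<n. pmf \<theta> j * real j)" by (rule sums_finite) (use supp in auto)
  then show "(\<Sum>j<n. pmf \<theta> j * real j) = c" by (rule sums_unique2) (use assms in \<open>simp add: prob_mean_iff\<close>)
qed

lemma sum_split_bottom:
  fixes g :: "nat \<Rightarrow> 'a :: comm_monoid_add"
  assumes "b + 2 \<le> n" "\<And>j. j < b \<Longrightarrow> g j = 0"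
  shows "(\<Sum>j<n. g j) = g b + (g (Suc b) + (\<Sum>j\<in>{b+2..<n}. g j))"
proof -
  have "(\<Sum>j<n. g j) = (\<Sum>j\<in>{b..<n}. g j)"
    by (rule sum.mono_neutral_right) (use assms in auto)
  also have "{b..<n} = insert b (insert (Suc b) {b+2..<n})" using assms by auto
  finally show ?thesis by simp
qed

lemma tendsto_entropy_term:
  assumes "(f \<longlongrightarrow> x) F" "\<And>i. 0 \<le> f i" "0 \<le> x" "0 < r"
  shows "((\<lambda>i. entropy_term r (f i)) \<longlongrightarrow> entropy_term r x) F"
  by (rule continuous_on_tendsto_compose[OF continuous_on_entropy_term assms(1)]) (use assms in auto)

context reference_measure
begin

text \<open>On a fixed finite range entropy is genuinely continuous; this is why truncation has to
  precede rounding.\<close>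

lemma tendsto_finite_entropy:
  assumes X: "\<And>i. X i \<in> prob_space_b b" and \<theta>: "\<theta> \<in> prob_space_b b"
    and lim: "\<And>j. ((\<lambda>i. pmf (X i) j) \<longlongrightarrow> pmf \<theta> j) F"
  shows "((\<lambda>i. \<Sum>j<n. pmf (X i) j * ln (pmf (X i) j / pmf \<rho> j))
    \<longlongrightarrow> (\<Sum>j<n. pmf \<theta> j * ln (pmf \<theta> j / pmf \<rho> j))) F"
proof (intro tendsto_sum)
  fix j
  show "((\<lambda>i. pmf (X i) j * ln (pmf (X i) j / pmf \<rho> j)) \<longlongrightarrow> pmf \<theta> j * ln (pmf \<theta> j / pmf \<rho> j)) F"
  proof (cases "b \<le> j")
    case True
    have "((\<lambda>i. entropy_term (pmf \<rho> j) (pmf (X i) j) + pmf (X i) j - pmf \<rho> j)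
        \<longlongrightarrow> entropy_term (pmf \<rho> j) (pmf \<theta> j) + pmf \<theta> j - pmf \<rho> j) F"
      by (intro tendsto_intros tendsto_entropy_term lim rho_pos[OF True]) auto
    then show ?thesis by (simp add: entropy_term_def)
  next
    case False
    then show ?thesis using X \<theta> by (simp add: prob_space_b_iff)
  qed
qed

text \<open>Later repairs take mass away from b and must leave it nonnegative, hence the demand for
  positive mass there. Mixing preserves the mean, as \<open>\<rho>\<close> also has mean c, and does
  not increase entropy.\<close>

lemma mixture_approximation:
  assumes \<rho>c: "\<rho> \<in> prob_mean b c" and \<theta>: "\<theta> \<in> G" and G: "openin (top_mean b c) G"
    and r: "rel_entropy b \<theta> \<rho> \<le> ereal r"
  shows "\<exists>\<psi>\<in>G. 0 < pmf \<psi> b \<and> rel_entropy b \<psi> \<rho> \<le> ereal r"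
proof -
  have \<theta>c: "\<theta> \<in> prob_mean b c" using openin_subset[OF G] \<theta> by (auto simp: top_mean_def)
  define d where "d n = 1 / real (n + 2)" for n
  have d: "0 < d n" "d n \<le> 1" for n by (auto simp: d_def)
  define q where "q n j = (1 - d n) * pmf \<theta> j + d n * pmf \<rho> j" for n j
  define X where "X n = embed_pmf (q n)" for n
  have "q n sums ((1 - d n) * 1 + d n * 1)" for n
    unfolding q_def by (intro sums_add sums_mult pmf_nat_sums_1)
  then have q1: "q n sums 1" for n by simp
  have pm: "pmf (X n) j = q n j" for n j
    unfolding X_def using d by (intro pmf_embed_pmf_nat q1) (auto simp: q_def less_imp_le)
  have "(\<lambda>j. (1 - d n) * (pmf \<theta> j * real j) + d n * (pmf \<rho> j * real j)) sums ((1 - d n) * c + d n * c)" for n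
    using \<theta>c \<rho>c by (intro sums_add sums_mult) (auto simp: prob_mean_iff)
  then have "(\<lambda>j. q n j * real j) sums c" for n by (simp add: q_def algebra_simps)
  then have X: "X n \<in> prob_mean b c" for n
    using \<theta>c \<rho>c by (simp add: prob_mean_iff pm prob_space_b_iff) (simp add: q_def)
  have "d \<longlonglongrightarrow> 0" unfolding d_def by real_asymp
  then have "(\<lambda>n. q n j) \<longlonglongrightarrow> (1 - 0) * pmf \<theta> j + 0 * pmf \<rho> j" for j
    unfolding q_def by (intro tendsto_intros)
  then have "eventually (\<lambda>n. X n \<in> G) sequentially"
    by (intro eventually_in_top_mean_open[OF G \<theta> X]) (simp add: pm)
  then obtain n where n: "X n \<in> G" by (auto dest: eventually_happens)
  have pos: "0 < pmf (X n) b"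
    unfolding pm q_def using d[of n] rho_pos[of b] by (intro add_nonneg_pos) auto
  have Xb: "X n \<in> prob_space_b b" "\<theta> \<in> prob_space_b b" using X[of n] \<theta>c by (auto simp: prob_mean_def)
  have le: "entropy_term (pmf \<rho> j) (pmf (X n) j) \<le> entropy_term (pmf \<rho> j) (pmf \<theta> j)" for j
  proof (cases "b \<le> j")
    case True
    show ?thesis unfolding pm q_def
      by (rule entropy_term_mixture) (use d[of n] rho_pos[OF True] in auto)
  next
    case False
    then show ?thesis using Xb by (simp add: prob_space_b_iff)
  qed
  have "(\<Sum>j<k. entropy_term (pmf \<rho> j) (pmf (X n) j)) \<le> r" for k
    using sum_mono[of "{..<k}", OF le] r unfolding rel_entropy_le_iff[OF Xb(2)] by (meson order_trans)
  then have "rel_entropy b (X n) \<rho> \<le> ereal r" by (simp add: rel_entropy_le_iff[OF Xb(1)])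
  then show ?thesis using n pos by blast
qed

lemma truncation_approximation:
  assumes \<theta>: "\<theta> \<in> G" and G: "openin (top_mean b c) G" and pos: "0 < pmf \<theta> b"
    and r: "rel_entropy b \<theta> \<rho> \<le> ereal r" and \<epsilon>: "0 < \<epsilon>"
  shows "\<exists>\<psi>\<in>G. \<exists>n\<ge>b+2. 0 < pmf \<psi> b \<and> (\<forall>j\<ge>n. pmf \<psi> j = 0) \<and> rel_entropy b \<psi> \<rho> \<le> ereal (r + \<epsilon>)"
proof -
  have \<theta>c: "\<theta> \<in> prob_mean b c" using openin_subset[OF G] \<theta> by (auto simp: top_mean_def)
  then have \<theta>b: "\<theta> \<in> prob_space_b b" and \<theta>m: "(\<lambda>j. pmf \<theta> j * real j) sums c"
    by (auto simp: prob_mean_iff)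
  have zero: "pmf \<theta> j = 0" if "j < b" for j using that \<theta>b by (simp add: prob_space_b_iff)
  let ?p = "pmf \<theta>"
  \<comment> \<open>The tail is cut off, and the masses \<open>x\<close> at \<open>b\<close> and \<open>y\<close> at \<open>b + 1\<close> are solved from the
    constraints on total mass and mean.\<close>
  define y where "y n = c - b - (\<Sum>j\<in>{b+2..<n}. (real j - b) * ?p j)" for n
  define x where "x n = 1 - y n - (\<Sum>j\<in>{b+2..<n}. ?p j)" for n
  define q where "q n j = (if j = b then x n else if j = Suc b then y n else if j < n then ?p j else 0)" for n j
  have "(\<lambda>j. ?p j * real j - b * ?p j) sums (c - real b * 1)"
    by (intro sums_diff \<theta>m sums_mult pmf_nat_sums_1)
  then have sm: "(\<lambda>j. (real j - b) * ?p j) sums (c - b)" by (simp add: algebra_simps)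
  have y_eq: "y n = c - b - (\<Sum>j<n. (real j - b) * ?p j) + ?p (Suc b)" if "b + 2 \<le> n" for n
    using sum_split_bottom[OF that, of "\<lambda>j. (real j - b) * ?p j"] zero by (simp add: y_def)
  have x_eq: "x n = 1 - y n - (\<Sum>j<n. ?p j) + ?p b + ?p (Suc b)" if "b + 2 \<le> n" for n
    using sum_split_bottom[OF that, of ?p] zero by (simp add: x_def)
  \<comment> \<open>The discarded places have excess j - b > 0 over b, and all of this excess moves
    to b + 1, whose mass can therefore only grow. The mass at b pays for it.\<close>
  have y_ge: "?p (Suc b) \<le> y n" if "b + 2 \<le> n" for n
  proof -
    have "0 \<le> (real j - b) * ?p j" for j using zero[of j] by (cases "b \<le> j") auto
    then have "(\<Sum>j<n. (real j - b) * ?p j) \<le> c - b"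
      using sum_le_suminf[OF sums_summable[OF sm], of "{..<n}"] sums_unique[OF sm] by simp
    then show ?thesis using y_eq[OF that] by simp
  qed
  have "(\<lambda>n. c - b - (\<Sum>j<n. (real j - b) * ?p j) + ?p (Suc b)) \<longlonglongrightarrow> c - b - (c - b) + ?p (Suc b)"
    using sm unfolding sums_def by (intro tendsto_intros)
  moreover have "eventually (\<lambda>n. c - b - (\<Sum>j<n. (real j - b) * ?p j) + ?p (Suc b) = y n) sequentially"
    using eventually_ge_at_top[of "b + 2"] by eventually_elim (simp add: y_eq)
  ultimately have y_lim: "y \<longlonglongrightarrow> ?p (Suc b)"
    by (auto elim: Lim_transform_eventually)
  have "(\<lambda>n. 1 - y n - (\<Sum>j<n. ?p j) + ?p b + ?p (Suc b)) \<longlonglongrightarrow> 1 - ?p (Suc b) - 1 + ?p b + ?p (Suc b)"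
    using pmf_nat_sums_1[of \<theta>] unfolding sums_def by (intro tendsto_intros y_lim)
  moreover have "eventually (\<lambda>n. 1 - y n - (\<Sum>j<n. ?p j) + ?p b + ?p (Suc b) = x n) sequentially"
    using eventually_ge_at_top[of "b + 2"] by eventually_elim (simp add: x_eq)
  ultimately have x_lim: "x \<longlonglongrightarrow> ?p b"
    by (auto elim: Lim_transform_eventually)
  define good where "good n \<longleftrightarrow> b + 2 \<le> n \<and> 0 < x n" for n
  have ev_good: "eventually good sequentially"
    unfolding good_def using eventually_ge_at_top[of "b + 2"] order_tendstoD(1)[OF x_lim pos]
    by (rule eventually_conj)
  have q_sum: "(\<Sum>j<n. q n j * f j) = x n * f b + (y n * f (Suc b) + (\<Sum>j\<in>{b+2..<n}. ?p j * f j))"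
    if "good n" for n f
  proof -
    have "(\<Sum>j<n. q n j * f j) = q n b * f b + (q n (Suc b) * f (Suc b) + (\<Sum>j\<in>{b+2..<n}. q n j * f j))"
      using that zero by (intro sum_split_bottom) (auto simp: good_def q_def)
    also have "(\<Sum>j\<in>{b+2..<n}. q n j * f j) = (\<Sum>j\<in>{b+2..<n}. ?p j * f j)"
      by (rule sum.cong) (auto simp: q_def)
    finally show ?thesis by (simp add: q_def)
  qed
  have q0: "0 \<le> q n j" if "good n" for n j
    using that order_trans[OF pmf_nonneg y_ge[of n]] by (auto simp: q_def good_def)
  have q_supp: "q n j = 0" if "good n" "j < b \<or> n \<le> j" for n j
    using that zero by (auto simp: q_def good_def)
  have q1: "(\<Sum>j<n. q n j) = 1" if "good n" for n
    using q_sum[OF that, of "\<lambda>_. 1"] by (simp add: x_def)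
  have qc: "(\<Sum>j<n. q n j * real j) = c" if "good n" for n
  proof -
    have "(\<Sum>j\<in>{b+2..<n}. (real j - b) * ?p j) = (\<Sum>j\<in>{b+2..<n}. ?p j * real j) - b * (\<Sum>j\<in>{b+2..<n}. ?p j)"
      by (simp add: algebra_simps sum_subtractf sum_distrib_left)
    then show ?thesis
      unfolding q_sum[OF that] by (simp add: x_def y_def algebra_simps)
  qed
  \<comment> \<open>The fallback \<theta> places every member of the sequence in
    \<open>prob_mean b c\<close>, as the topological lemma requires.\<close>
  define X where "X n = (if good n then embed_pmf (q n) else \<theta>)" for n
  have pm: "pmf (X n) j = q n j" if "good n" for n j
    using embed_pmf_finite_support(1)[OF q0[OF that] q_supp[OF that] q1[OF that] qc[OF that]] that
    by (simp add: X_def)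
  have X: "X n \<in> prob_mean b c" for n
    using embed_pmf_finite_support(2)[OF q0 q_supp q1 qc] \<theta>c by (auto simp: X_def)
  have Xlim: "(\<lambda>n. pmf (X n) j) \<longlonglongrightarrow> ?p j" for j
  proof -
    have "(\<lambda>n. q n j) \<longlonglongrightarrow> ?p j"
    proof -
      consider "j = b" | "j = Suc b" | "j \<noteq> b" "j \<noteq> Suc b" by blast
      then show ?thesis
      proof cases
        case 3
        have "eventually (\<lambda>n. ?p j = q n j) sequentially"
          using eventually_gt_at_top[of j] by eventually_elim (use 3 in \<open>simp add: q_def\<close>)
        then show ?thesis by (rule Lim_transform_eventually[rotated]) simp
      qed (use x_lim y_lim in \<open>simp_all add: q_def\<close>)
    qed
    moreover have "eventually (\<lambda>n. q n j = pmf (X n) j) sequentially"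
      using ev_good by eventually_elim (simp add: pm)
    ultimately show ?thesis by (rule Lim_transform_eventually)
  qed
  have ev_G: "eventually (\<lambda>n. X n \<in> G) sequentially"
    by (rule eventually_in_top_mean_open[OF G \<theta> X Xlim])
  let ?E = "\<lambda>j. entropy_term (pmf \<rho> j)"
  \<comment> \<open>Only the terms at b and b + 1 change. The final summand appears because the
    corrections \<open>r - x\<close> no longer cancel: the truncated measure has its whole mass
    below n, \<open>\<rho>\<close> has not.\<close>
  let ?D = "\<lambda>n. r + (?E b (pmf (X n) b) - ?E b (?p b)) + (?E (Suc b) (pmf (X n) (Suc b)) - ?E (Suc b) (?p (Suc b)))
     + (1 - (\<Sum>j<n. pmf \<rho> j))"
  have "?D \<longlonglongrightarrow> r + (?E b (?p b) - ?E b (?p b)) + (?E (Suc b) (?p (Suc b)) - ?E (Suc b) (?p (Suc b))) + (1 - 1)"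
    using pmf_nat_sums_1[of \<rho>] unfolding sums_def
    by (intro tendsto_intros tendsto_entropy_term Xlim rho_pos) auto
  then have ev_D: "eventually (\<lambda>n. ?D n < r + \<epsilon>) sequentially"
    using \<epsilon> by (intro order_tendstoD(2)) auto
  have "eventually (\<lambda>n. good n \<and> X n \<in> G \<and> ?D n < r + \<epsilon>) sequentially"
    using ev_good ev_G ev_D by eventually_elim simp
  then obtain n where n: "good n" "X n \<in> G" "?D n < r + \<epsilon>"
    by (auto dest: eventually_happens)
  have n2: "b + 2 \<le> n" using n by (simp add: good_def)
  have Xb: "X n \<in> prob_space_b b" using X[of n] by (simp add: prob_mean_def)
  have "rel_entropy b (X n) \<rho> = ereal (\<Sum>j<n. pmf (X n) j * ln (pmf (X n) j / pmf \<rho> j))"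
    by (rule rel_entropy_finite_support[OF Xb]) (use n q_supp in \<open>auto simp: pm\<close>)
  also have "(\<Sum>j<n. pmf (X n) j * ln (pmf (X n) j / pmf \<rho> j))
     = (\<Sum>j<n. ?E j (pmf (X n) j)) + (1 - (\<Sum>j<n. pmf \<rho> j))"
    using q1[OF n(1)] by (simp add: entropy_term_def sum.distrib sum_subtractf pm[OF n(1)])
  also have "(\<Sum>j<n. ?E j (pmf (X n) j)) = (\<Sum>j<n. ?E j (?p j))
      + (?E b (pmf (X n) b) - ?E b (?p b)) + (?E (Suc b) (pmf (X n) (Suc b)) - ?E (Suc b) (?p (Suc b)))"
  proof -
    have z: "?E j (pmf \<psi> j) = 0" if "\<psi> \<in> prob_space_b b" "j < b" for \<psi> j
      using that rho_space by (simp add: prob_space_b_iff entropy_term_def)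
    have "(\<Sum>j\<in>{b+2..<n}. ?E j (pmf (X n) j)) = (\<Sum>j\<in>{b+2..<n}. ?E j (?p j))"
      by (rule sum.cong) (auto simp: pm[OF n(1)] q_def)
    then show ?thesis
      using sum_split_bottom[OF n2, of "\<lambda>j. ?E j (pmf (X n) j)"] sum_split_bottom[OF n2, of "\<lambda>j. ?E j (?p j)"]
        z[OF Xb] z[OF \<theta>b] by simp
  qed
  also have "(\<Sum>j<n. ?E j (?p j)) \<le> r" using r by (simp add: rel_entropy_le_iff[OF \<theta>b])
  finally have "rel_entropy b (X n) \<rho> \<le> ereal (?D n)" by simp
  also have "\<dots> \<le> ereal (r + \<epsilon>)" using n(3) by simp
  finally have R: "rel_entropy b (X n) \<rho> \<le> ereal (r + \<epsilon>)" .
  have "0 < pmf (X n) b" using n by (simp add: pm good_def q_def)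
  moreover have "\<forall>j\<ge>n. pmf (X n) j = 0" using q_supp[OF n(1)] by (simp add: pm[OF n(1)])
  ultimately show ?thesis using n(2) n2 R by blast
qed

end

section \<open>Rounding to integer occupation numbers\<close>

lemma particles_admissible:
  assumes "N \<in> admissible c" "0 \<le> c"
  shows "real (particles c N) = c * real N"
proof -
  have "c * real N \<in> \<int>" using assms by (simp add: admissible_def)
  then have "real_of_int \<lfloor>c * real N\<rfloor> = c * real N" by (simp add: of_int_floor)
  then show ?thesis using assms by (simp add: particles_def)
qed

lemma eventually_along_admissible: "eventually (\<lambda>N. N \<in> admissible c) (along c)"
  unfolding along_def by (simp add: eventually_inf_principal)

lemma along_le_sequentially: "along c \<le> sequentially"
  unfolding along_def by simp

lemma pmf_of_multiset_in_prob_mean: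
  assumes size: "size \<nu> = N" "0 < N" and sum: "real (sum_mset \<nu>) = c * real N" and b: "\<forall>j\<in>#\<nu>. b \<le> j"
  shows "pmf_of_multiset \<nu> \<in> prob_mean b c"
proof -
  have ne: "\<nu> \<noteq> {#}" using size by auto
  have "(\<lambda>j. pmf (pmf_of_multiset \<nu>) j * real j) sums (\<Sum>j\<in>set_mset \<nu>. pmf (pmf_of_multiset \<nu>) j * real j)"
    by (rule sums_finite) (use ne in \<open>auto simp: not_in_iff\<close>)
  also have "(\<Sum>j\<in>set_mset \<nu>. pmf (pmf_of_multiset \<nu>) j * real j) = (\<Sum>j\<in>set_mset \<nu>. real (count \<nu> j) * real j) / N"
    using ne size by (simp add: sum_divide_distrib)
  also have "(\<Sum>j\<in>set_mset \<nu>. real (count \<nu> j) * real j) = c * real N"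
    using sum_mset_eq_sum_count[of real \<nu>] sum by (metis of_nat_sum_mset)
  finally show ?thesis using b ne size by (auto simp: prob_mean_iff prob_space_b_def)
qed

lemma tendsto_floor_fraction:
  assumes "0 \<le> x"
  shows "(\<lambda>N. real (nat \<lfloor>real N * x\<rfloor>) / real N) \<longlonglongrightarrow> x"
proof (rule tendsto_sandwich)
  show "(\<lambda>N. x - 1 / real N) \<longlonglongrightarrow> x" by real_asymp
  show "(\<lambda>_. x) \<longlonglongrightarrow> x" by simp
  have fl: "real (nat \<lfloor>real N * x\<rfloor>) = real_of_int \<lfloor>real N * x\<rfloor>" for N
    using assms by simp
  show "eventually (\<lambda>N. x - 1 / real N \<le> real (nat \<lfloor>real N * x\<rfloor>) / real N) sequentially"
    using eventually_gt_at_top[of 0]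
  proof eventually_elim
    case (elim N)
    have "real N * x - 1 \<le> real_of_int \<lfloor>real N * x\<rfloor>" by linarith
    then have "(real N * x - 1) / real N \<le> real_of_int \<lfloor>real N * x\<rfloor> / real N"
      by (rule divide_right_mono) simp
    then show ?case unfolding fl using elim by (simp add: diff_divide_distrib)
  qed
  show "eventually (\<lambda>N. real (nat \<lfloor>real N * x\<rfloor>) / real N \<le> x) sequentially"
    using eventually_gt_at_top[of 0]
  proof eventually_elim
    case (elim N)
    have "real_of_int \<lfloor>real N * x\<rfloor> / real N \<le> (real N * x) / real N"
      by (rule divide_right_mono) auto
    then show ?case unfolding fl using elim by simp
  qed
qed

context reference_measure
begin

lemma lattice_approximation:
  assumes c: "0 \<le> c" and m: "filterlim m at_top (along c)"
    and \<psi>: "\<psi> \<in> G" and G: "openin (top_mean b c) G"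
    and n: "b + 2 \<le> n" and supp: "\<And>j. n \<le> j \<Longrightarrow> pmf \<psi> j = 0" and pos: "0 < pmf \<psi> b"
    and r: "rel_entropy b \<psi> \<rho> \<le> ereal r" and \<epsilon>: "0 < \<epsilon>"
  shows "eventually (\<lambda>N. \<exists>\<nu>\<in>occ_types b c m N. pmf_of_multiset \<nu> \<in> G \<and>
    rel_entropy b (pmf_of_multiset \<nu>) \<rho> \<le> ereal (r + \<epsilon>)) (along c)"
proof -
  have \<psi>c: "\<psi> \<in> prob_mean b c" using openin_subset[OF G] \<psi> by (auto simp: top_mean_def)
  then have \<psi>b: "\<psi> \<in> prob_space_b b" by (simp add: prob_mean_def)
  let ?p = "pmf \<psi>"
  let ?I = "{b+2..<n}"
  have zero: "?p j = 0" if "j < b" for j using that \<psi>b by (simp add: prob_space_b_iff)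
  have p1: "?p b + (?p (Suc b) + (\<Sum>j\<in>?I. ?p j)) = 1"
    using prob_mean_finite_support(1)[OF \<psi>c supp] sum_split_bottom[OF n, of ?p] zero by simp
  have pc: "?p b * b + (?p (Suc b) * Suc b + (\<Sum>j\<in>?I. ?p j * j)) = c"
    using prob_mean_finite_support(2)[OF \<psi>c supp] sum_split_bottom[OF n, of "\<lambda>j. ?p j * j"] zero by simp
  have pI: "(\<Sum>j\<in>?I. (real j - b) * ?p j) = (\<Sum>j\<in>?I. ?p j * j) - b * (\<Sum>j\<in>?I. ?p j)"
    by (simp add: algebra_simps sum_subtractf sum_distrib_left)
  have py: "?p (Suc b) = c - b - (\<Sum>j\<in>?I. (real j - b) * ?p j)"
  proof -
    have "real b * ?p b = real b * (1 - ?p (Suc b) - (\<Sum>j\<in>?I. ?p j))" using p1 by simp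
    then show ?thesis unfolding pI using pc by (simp add: algebra_simps)
  qed
  \<comment> \<open>Round down above \<open>b + 1\<close>; the two linear constraints then determine integer values \<open>X\<close> at
    \<open>b\<close> and \<open>Y\<close> at \<open>b + 1\<close>, and rounding down guarantees \<open>Y \<ge> 0\<close>.\<close>
  define k where "k N j = nat \<lfloor>real N * ?p j\<rfloor>" for N j
  define Y where "Y N = int (particles c N) - int b * int N - (\<Sum>j\<in>?I. (int j - int b) * int (k N j))" for N
  define X where "X N = int N - Y N - (\<Sum>j\<in>?I. int (k N j))" for N
  define good where "good N \<longleftrightarrow> N \<in> admissible c \<and> 0 \<le> X N" for N
  define h where "h N j = (if j = b then nat (X N) else if j = Suc b then nat (Y N) else if j \<in> ?I then k N j else 0)" for N j
  define \<nu> where "\<nu> N = (\<Sum>j<n. replicate_mset (h N j) j)" for N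
  have Npos: "0 < N" if "N \<in> admissible c" for N using that by (simp add: admissible_def)
  have Y_real: "real_of_int (Y N) = c * N - b * N - (\<Sum>j\<in>?I. (real j - b) * k N j)" if "N \<in> admissible c" for N
    using particles_admissible[OF that c] by (simp add: Y_def)
  have Y_nonneg: "0 \<le> Y N" if "N \<in> admissible c" for N
  proof -
    have "(\<Sum>j\<in>?I. (real j - b) * k N j) \<le> (\<Sum>j\<in>?I. (real j - b) * (N * ?p j))"
      by (intro sum_mono mult_left_mono) (auto simp: k_def)
    also have "\<dots> = N * (\<Sum>j\<in>?I. (real j - b) * ?p j)"
      by (simp add: sum_distrib_left mult_ac)
    also have "\<dots> = N * (c - b - ?p (Suc b))" using py by simp
    finally have "N * ?p (Suc b) \<le> real_of_int (Y N)"
      unfolding Y_real[OF that] by (simp add: algebra_simps)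
    moreover have "0 \<le> N * ?p (Suc b)" by simp
    ultimately have "0 \<le> real_of_int (Y N)" by (rule order_trans[rotated])
    then show ?thesis by simp
  qed
  have hsum: "(\<Sum>j<n. int (h N j) * f j) = X N * f b + (Y N * f (Suc b) + (\<Sum>j\<in>?I. int (k N j) * f j))"
    if "good N" for N f
  proof -
    have "(\<Sum>j<n. int (h N j) * f j) = int (h N b) * f b + (int (h N (Suc b)) * f (Suc b) + (\<Sum>j\<in>?I. int (h N j) * f j))"
      by (rule sum_split_bottom[OF n]) (auto simp: h_def)
    also have "(\<Sum>j\<in>?I. int (h N j) * f j) = (\<Sum>j\<in>?I. int (k N j) * f j)"
      by (rule sum.cong) (auto simp: h_def)
    finally show ?thesis using that Y_nonneg[of N] by (simp add: h_def good_def)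
  qed
  have count: "count (\<nu> N) j = h N j" for N j
    using n by (simp add: \<nu>_def count_sum) (simp add: h_def)
  have size: "size (\<nu> N) = N" if "good N" for N
  proof -
    have "int (size (\<nu> N)) = (\<Sum>j<n. int (h N j))" by (simp add: \<nu>_def size_multiset_sum)
    also have "\<dots> = int N" using hsum[OF that, of "\<lambda>_. 1"] by (simp add: X_def)
    finally show ?thesis by simp
  qed
  have sum: "sum_mset (\<nu> N) = particles c N" if "good N" for N
  proof -
    have "sum_mset (\<nu> N) = (\<Sum>j<n. h N j * j)"
      unfolding \<nu>_def by (induction n) (auto simp: sum_mset_replicate_mset)
    then have "int (sum_mset (\<nu> N)) = (\<Sum>j<n. int (h N j) * int j)" by simp
    also have "\<dots> = X N * int b + (Y N * (int b + 1) + (\<Sum>j\<in>?I. int (k N j) * int j))"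
      using hsum[OF that, of int] by (simp add: algebra_simps)
    also have "\<dots> = int b * int N + Y N + (\<Sum>j\<in>?I. (int j - int b) * int (k N j))"
      by (simp add: X_def algebra_simps sum_subtractf sum_distrib_left)
    also have "\<dots> = int (particles c N)" by (simp add: Y_def)
    finally show ?thesis by (simp only: of_nat_eq_iff)
  qed
  have hzero: "h N j = 0" if "j < b \<or> n \<le> j" for N j
    using that n by (auto simp: h_def)
  have ge_b: "\<forall>j\<in>#\<nu> N. b \<le> j" for N
    using hzero count by (metis not_in_iff not_le)
  have sub: "set_mset (\<nu> N) \<subseteq> {..<n}" for N
    using hzero count by (metis lessThan_iff not_in_iff not_le subsetI)
  define Q where "Q N = (if good N then pmf_of_multiset (\<nu> N) else \<psi>)" for N
  have Q: "Q N \<in> prob_mean b c" for N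
  proof (cases "good N")
    case True
    then have adm: "N \<in> admissible c" by (simp add: good_def)
    have "pmf_of_multiset (\<nu> N) \<in> prob_mean b c"
      by (rule pmf_of_multiset_in_prob_mean[OF size[OF True] Npos[OF adm] _ ge_b])
        (simp add: sum[OF True] particles_admissible[OF adm c])
    then show ?thesis using True by (simp add: Q_def)
  qed (simp add: Q_def \<psi>c)
  have pmQ: "pmf (Q N) j = h N j / N" if "good N" for N j
  proof -
    have "\<nu> N \<noteq> {#}" using size[OF that] Npos[of N] that by (auto simp: good_def)
    then show ?thesis using that by (simp add: Q_def size count)
  qed
  have k_lim: "((\<lambda>N. k N j / N) \<longlongrightarrow> ?p j) (along c)" for j
    unfolding k_def by (rule tendsto_mono[OF along_le_sequentially tendsto_floor_fraction]) simp
  have Y_lim: "((\<lambda>N. real_of_int (Y N) / N) \<longlongrightarrow> ?p (Suc b)) (along c)"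
  proof (rule Lim_transform_eventually)
    show "((\<lambda>N. c - b - (\<Sum>j\<in>?I. (real j - b) * (k N j / N))) \<longlongrightarrow> ?p (Suc b)) (along c)"
      unfolding py by (intro tendsto_intros k_lim)
    show "eventually (\<lambda>N. c - b - (\<Sum>j\<in>?I. (real j - b) * (k N j / N)) = real_of_int (Y N) / N) (along c)"
      using eventually_along_admissible
    proof eventually_elim
      case (elim N)
      show ?case using Npos[OF elim] unfolding Y_real[OF elim]
        by (simp add: diff_divide_distrib sum_divide_distrib)
    qed
  qed
  have X_lim: "((\<lambda>N. real_of_int (X N) / N) \<longlongrightarrow> ?p b) (along c)"
  proof (rule Lim_transform_eventually)
    have "((\<lambda>N. 1 - real_of_int (Y N) / N - (\<Sum>j\<in>?I. k N j / N)) \<longlongrightarrow> 1 - ?p (Suc b) - (\<Sum>j\<in>?I. ?p j)) (along c)"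
      by (intro tendsto_intros k_lim Y_lim)
    also have "1 - ?p (Suc b) - (\<Sum>j\<in>?I. ?p j) = ?p b" using p1 by simp
    finally show "((\<lambda>N. 1 - real_of_int (Y N) / N - (\<Sum>j\<in>?I. k N j / N)) \<longlongrightarrow> ?p b) (along c)" .
    show "eventually (\<lambda>N. 1 - real_of_int (Y N) / N - (\<Sum>j\<in>?I. k N j / N) = real_of_int (X N) / N) (along c)"
      using eventually_along_admissible
    proof eventually_elim
      case (elim N)
      show ?case using Npos[OF elim]
        by (simp add: X_def diff_divide_distrib sum_divide_distrib)
    qed
  qed
  \<comment> \<open>The only sign in doubt is that of X. It is settled by the positive mass at b,
    the limit of X / N.\<close>
  have ev_good: "eventually good (along c)"
    using eventually_along_admissible order_tendstoD(1)[OF X_lim pos]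
    by eventually_elim (auto simp: good_def zero_less_divide_iff)
  have Q_lim: "((\<lambda>N. pmf (Q N) j) \<longlongrightarrow> ?p j) (along c)" for j
  proof -
    consider "j = b" | "j = Suc b" | "j \<in> ?I" | "j < b \<or> n \<le> j" using n by force
    then show ?thesis
    proof cases
      case 1
      have "eventually (\<lambda>N. real_of_int (X N) / N = pmf (Q N) j) (along c)"
        using ev_good by eventually_elim (use 1 in \<open>simp add: pmQ h_def good_def\<close>)
      then show ?thesis using X_lim 1 by (auto elim: Lim_transform_eventually)
    next
      case 2
      have "eventually (\<lambda>N. real_of_int (Y N) / N = pmf (Q N) j) (along c)"
        using ev_good by eventually_elim (use 2 Y_nonneg in \<open>simp add: pmQ h_def good_def\<close>)
      then show ?thesis using Y_lim 2 by (auto elim: Lim_transform_eventually)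
    next
      case 3
      have "eventually (\<lambda>N. k N j / N = pmf (Q N) j) (along c)"
        using ev_good by eventually_elim (use 3 in \<open>simp add: pmQ h_def\<close>)
      then show ?thesis using k_lim[of j] by (auto elim: Lim_transform_eventually)
    next
      case 4
      have "eventually (\<lambda>N. ?p j = pmf (Q N) j) (along c)"
        using ev_good by eventually_elim (use 4 zero supp hzero in \<open>auto simp: pmQ\<close>)
      then show ?thesis by (rule Lim_transform_eventually[rotated]) simp
    qed
  qed
  have ev_G: "eventually (\<lambda>N. Q N \<in> G) (along c)"
    by (rule eventually_in_top_mean_open[OF G \<psi> Q Q_lim])
  have Qb: "Q N \<in> prob_space_b b" for N using Q[of N] by (simp add: prob_mean_def)
  have ent: "rel_entropy b \<psi> \<rho> = ereal (\<Sum>j<n. ?p j * ln (?p j / pmf \<rho> j))"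
    by (rule rel_entropy_finite_support[OF \<psi>b supp])
  have "((\<lambda>N. \<Sum>j<n. pmf (Q N) j * ln (pmf (Q N) j / pmf \<rho> j))
    \<longlongrightarrow> (\<Sum>j<n. ?p j * ln (?p j / pmf \<rho> j))) (along c)"
    by (rule tendsto_finite_entropy[OF Qb \<psi>b Q_lim])
  then have ev_ent: "eventually (\<lambda>N. (\<Sum>j<n. pmf (Q N) j * ln (pmf (Q N) j / pmf \<rho> j)) < r + \<epsilon>) (along c)"
    by (rule order_tendstoD(2)) (use r \<epsilon> ent in simp)
  \<comment> \<open>All types built here have at most n distinct occupation numbers, so the growth
    of m makes them admissible eventually.\<close>
  have ev_m: "eventually (\<lambda>N. n \<le> m N) (along c)"
    using m by (simp add: filterlim_at_top)
  from ev_good ev_G ev_ent ev_m show ?thesis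
  proof eventually_elim
    case (elim N)
    have "card (set_mset (\<nu> N)) \<le> n" using card_mono[OF _ sub[of N]] by simp
    then have "\<nu> N \<in> occ_types b c m N"
      using elim size sum ge_b by (simp add: occ_types_def)
    moreover have "rel_entropy b (Q N) \<rho> \<le> ereal (r + \<epsilon>)"
      using elim by (subst rel_entropy_finite_support[OF Qb, of n]) (auto simp: pmQ hzero)
    ultimately show ?case using elim by (auto simp: Q_def intro!: bexI[of _ "\<nu> N"])
  qed
qed

text \<open>Mixing costs no entropy, so \<epsilon> is divided between truncation and
  rounding.\<close>

lemma type_approximation:
  assumes c: "0 \<le> c" and m: "filterlim m at_top (along c)" and \<rho>c: "\<rho> \<in> prob_mean b c"
    and \<theta>: "\<theta> \<in> G" and G: "openin (top_mean b c) G"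
    and r: "rel_entropy b \<theta> \<rho> \<le> ereal r" and \<epsilon>: "0 < \<epsilon>"
  shows "eventually (\<lambda>N. \<exists>\<nu>\<in>occ_types b c m N. pmf_of_multiset \<nu> \<in> G \<and>
    rel_entropy b (pmf_of_multiset \<nu>) \<rho> \<le> ereal (r + \<epsilon>)) (along c)"
proof -
  obtain \<phi> where \<phi>: "\<phi> \<in> G" "0 < pmf \<phi> b" "rel_entropy b \<phi> \<rho> \<le> ereal r"
    using mixture_approximation[OF \<rho>c \<theta> G r] by auto
  obtain \<psi> n where \<psi>: "\<psi> \<in> G" "b + 2 \<le> n" "0 < pmf \<psi> b" "\<And>j. n \<le> j \<Longrightarrow> pmf \<psi> j = 0"
    "rel_entropy b \<psi> \<rho> \<le> ereal (r + \<epsilon> / 2)"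
    using truncation_approximation[OF \<phi>(1) G \<phi>(2,3), of "\<epsilon> / 2"] \<epsilon> by auto
  show ?thesis
    using lattice_approximation[OF c m \<psi>(1) G \<psi>(2,4,3,5), of "\<epsilon> / 2"] \<epsilon> by (simp add: add.commute)
qed

end

section \<open>From counts to probabilities\<close>

definition config_count :: "nat \<Rightarrow> real \<Rightarrow> (nat \<Rightarrow> nat) \<Rightarrow> nat pmf set \<Rightarrow> nat \<Rightarrow> nat" where
  "config_count b c m A N = card {\<omega> \<in> constrained_configs b c m N. number_density c N \<omega> \<in> A}"

text \<open>The part \<open>1 + ln N\<close> is the Stirling error of a single class; the last
  logarithm accounts for the number of classes.\<close>

definition count_error :: "real \<Rightarrow> (nat \<Rightarrow> nat) \<Rightarrow> nat \<Rightarrow> real" where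
  "count_error c m N = real (m N) * (1 + ln (real N) + ln (real ((particles c N + 1) * (N + 1))))"

text \<open>The entropy hypothesis is restricted to \<open>prob_space_b b\<close> so that A =
  \<open>UNIV\<close> with r = 0 also bounds the total count.\<close>

lemma config_count_upper:
  assumes \<alpha>: "0 < \<alpha>" and N: "0 < N" and A: "\<And>\<theta>. \<theta> \<in> A \<Longrightarrow> \<theta> \<in> prob_space_b b \<Longrightarrow> ereal r \<le> rel_entropy b \<theta> (rho b \<alpha>)"
  shows "real (config_count b c m A N) \<le> exp (log_volume b \<alpha> c N - real N * r + count_error c m N)"
proof -
  let ?E = "exp (log_volume b \<alpha> c N - real N * r + real (m N) * (1 + ln (real N)))"
  let ?B = "(particles c N + 1) * (N + 1)"
  define T where "T = {\<nu> \<in> occ_types b c m N. pmf_of_multiset \<nu> \<in> A}"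
  have fin: "finite T" unfolding T_def using card_occ_types(1) by auto
  have class_le: "real (card (occ_class c N \<nu>)) \<le> ?E" if "\<nu> \<in> T" for \<nu>
  proof -
    have \<nu>: "size \<nu> = N" "sum_mset \<nu> = particles c N" "\<forall>j\<in>#\<nu>. b \<le> j" "card (set_mset \<nu>) \<le> m N"
      "pmf_of_multiset \<nu> \<in> A"
      using that by (auto simp: T_def occ_types_def)
    obtain R where R: "rel_entropy b (pmf_of_multiset \<nu>) (rho b \<alpha>) = ereal R"
      "0 < card (occ_class c N \<nu>)"
      "\<bar>ln (card (occ_class c N \<nu>)) - (log_volume b \<alpha> c N - real N * R)\<bar> \<le> real (m N) * (1 + ln (real N))"
      using ln_card_occ_class[OF \<alpha> N \<nu>(1-4)] .
    have "pmf_of_multiset \<nu> \<in> prob_space_b b"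
      using \<nu>(1,3) N by (cases "\<nu> = {#}") (auto simp: prob_space_b_def)
    then have "r \<le> R" using A[OF \<nu>(5)] R(1) by simp
    then have "real N * r \<le> real N * R" by (intro mult_left_mono) auto
    then have "ln (card (occ_class c N \<nu>)) \<le> log_volume b \<alpha> c N - real N * r + real (m N) * (1 + ln (real N))"
      using R(3) by linarith
    then show ?thesis using R(2) by (metis exp_le_cancel_iff exp_ln of_nat_0_less_iff)
  qed
  have "{\<omega> \<in> constrained_configs b c m N. number_density c N \<omega> \<in> A} \<subseteq> (\<Union>\<nu>\<in>T. occ_class c N \<nu>)"
    unfolding constrained_configs_eq T_def using number_density_eq[OF _ N] by auto
  then have "config_count b c m A N \<le> card (\<Union>\<nu>\<in>T. occ_class c N \<nu>)"
    unfolding config_count_def using fin by (intro card_mono) auto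
  also have "\<dots> \<le> (\<Sum>\<nu>\<in>T. card (occ_class c N \<nu>))" by (rule card_UN_le[OF fin])
  finally have "real (config_count b c m A N) \<le> (\<Sum>\<nu>\<in>T. real (card (occ_class c N \<nu>)))"
    by (simp flip: of_nat_sum)
  also have "\<dots> \<le> real (card T) * ?E" using sum_mono[OF class_le] by simp
  also have "\<dots> \<le> exp (real (m N) * ln (real ?B)) * ?E"
  proof (rule mult_right_mono)
    have "card T \<le> card (occ_types b c m N)"
      unfolding T_def by (rule card_mono) (auto simp: card_occ_types)
    also have "\<dots> \<le> ?B ^ m N" by (rule card_occ_types)
    finally have "real (card T) \<le> real (?B ^ m N)" by (simp only: of_nat_le_iff)
    also have "\<dots> = real ?B ^ m N" by simp
    also have "\<dots> = exp (real (m N) * ln (real ?B))"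
      by (simp add: exp_of_nat_mult del: of_nat_mult of_nat_add of_nat_Suc)
    finally show "real (card T) \<le> exp (real (m N) * ln (real ?B))" .
  qed simp
  also have "\<dots> = exp (log_volume b \<alpha> c N - real N * r + count_error c m N)"
    by (simp add: exp_add[symmetric] count_error_def algebra_simps)
  finally show ?thesis .
qed

lemma config_count_lower:
  assumes \<alpha>: "0 < \<alpha>" and N: "0 < N" and \<nu>: "\<nu> \<in> occ_types b c m N" "pmf_of_multiset \<nu> \<in> A"
    and r: "rel_entropy b (pmf_of_multiset \<nu>) (rho b \<alpha>) \<le> ereal r"
  shows "exp (log_volume b \<alpha> c N - real N * r - count_error c m N) \<le> real (config_count b c m A N)"
proof -
  have \<nu>': "size \<nu> = N" "sum_mset \<nu> = particles c N" "\<forall>j\<in>#\<nu>. b \<le> j" "card (set_mset \<nu>) \<le> m N"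
    using \<nu> by (auto simp: occ_types_def)
  obtain R where R: "rel_entropy b (pmf_of_multiset \<nu>) (rho b \<alpha>) = ereal R"
    "0 < card (occ_class c N \<nu>)"
    "\<bar>ln (card (occ_class c N \<nu>)) - (log_volume b \<alpha> c N - real N * R)\<bar> \<le> real (m N) * (1 + ln (real N))"
    using ln_card_occ_class[OF \<alpha> N \<nu>'] .
  have "R \<le> r" using r R(1) by simp
  then have "real N * R \<le> real N * r" by (intro mult_left_mono) auto
  moreover have "real (m N) * (1 + ln (real N)) \<le> count_error c m N"
    unfolding count_error_def by (intro mult_left_mono) (auto intro!: ln_ge_zero simp flip: of_nat_mult)
  ultimately have "log_volume b \<alpha> c N - real N * r - count_error c m N \<le> ln (card (occ_class c N \<nu>))"
    using R(3) by linarith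
  then have "exp (log_volume b \<alpha> c N - real N * r - count_error c m N) \<le> real (card (occ_class c N \<nu>))"
    using R(2) by (subst ln_ge_iff[symmetric]) auto
  also have "card (occ_class c N \<nu>) \<le> config_count b c m A N"
    unfolding config_count_def
    by (rule card_mono) (use \<nu> number_density_eq[OF _ N] in \<open>auto simp: constrained_configs_eq card_occ_types(1)\<close>)
  finally show ?thesis by simp
qed

text \<open>Split m / N as the square root of m^2 / N times 1 / sqrt N; the second factor absorbs
  the logarithms.\<close>

lemma count_error_tendsto:
  assumes c: "0 < c" and m: "((\<lambda>N. real (m N)^2 / real N) \<longlongrightarrow> 0) (along c)"
  shows "((\<lambda>N. count_error c m N / real N) \<longlongrightarrow> 0) (along c)"
proof -
  let ?g = "\<lambda>N. (1 + ln (real N) + ln ((c * real N + 1) * (real N + 1))) / sqrt (real N)"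
  have "?g \<longlonglongrightarrow> 0" using c by real_asymp
  then have g: "(?g \<longlongrightarrow> 0) (along c)" by (rule tendsto_mono[OF along_le_sequentially])
  have "((\<lambda>N. sqrt (real (m N)^2 / real N) * ?g N) \<longlongrightarrow> sqrt 0 * 0) (along c)"
    by (intro tendsto_mult tendsto_real_sqrt m g)
  then have "((\<lambda>N. sqrt (real (m N)^2 / real N) * ?g N) \<longlongrightarrow> 0) (along c)" by simp
  moreover have "eventually (\<lambda>N. sqrt (real (m N)^2 / real N) * ?g N = count_error c m N / real N) (along c)"
    using eventually_along_admissible
  proof eventually_elim
    case (elim N)
    let ?h = "1 + ln (real N) + ln ((c * real N + 1) * (real N + 1))"
    have "sqrt (real (m N)^2 / real N) * ?g N = real (m N) * ?h / (sqrt (real N) * sqrt (real N))"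
      by (simp add: real_sqrt_divide)
    also have "sqrt (real N) * sqrt (real N) = real N" by simp
    also have "real (m N) * ?h = count_error c m N"
    proof -
      have "(c * real N + 1) * (real N + 1) = real ((particles c N + 1) * (N + 1))"
        using particles_admissible[OF elim] c by (simp add: algebra_simps)
      then show ?thesis by (simp only: count_error_def)
    qed
    finally show ?case .
  qed
  ultimately show ?thesis by (rule Lim_transform_eventually)
qed

text \<open>Nonemptiness matters because \<open>pmf_of_set\<close> is unspecified on the empty
  set.\<close>

lemma prob_uniform_P:
  assumes "constrained_configs b c m N \<noteq> {}"
  shows "measure_pmf.prob (uniform_P b c m N) {\<omega>. number_density c N \<omega> \<in> A}
    = real (config_count b c m A N) / real (config_count b c m UNIV N)"
  unfolding uniform_P_def measure_pmf_of_set[OF assms finite_constrained_configs] config_count_def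
  by (simp add: Int_def)

lemma log_rate_le:
  assumes "0 < N" "measure_pmf.prob (uniform_P b c m N) {\<omega>. number_density c N \<omega> \<in> A} \<le> exp (real N * s)"
  shows "log_rate b c m A N \<le> ereal s"
proof -
  let ?P = "measure_pmf.prob (uniform_P b c m N) {\<omega>. number_density c N \<omega> \<in> A}"
  show ?thesis
  proof (cases "?P = 0")
    case True
    then show ?thesis using assms by (simp add: log_rate_def ext_ln_def)
  next
    case False
    then have P: "0 < ?P" by (simp add: zero_less_measure_iff)
    then have "ln ?P \<le> real N * s" using assms(2) by (metis exp_le_cancel_iff exp_ln)
    then have "1 / real N * ln ?P \<le> s" using assms(1) by (simp add: field_simps)
    then show ?thesis using P by (simp add: log_rate_def ext_ln_def)
  qed
qed

lemma log_rate_ge: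
  assumes "0 < N" "exp (real N * s) \<le> measure_pmf.prob (uniform_P b c m N) {\<omega>. number_density c N \<omega> \<in> A}"
  shows "ereal s \<le> log_rate b c m A N"
proof -
  let ?P = "measure_pmf.prob (uniform_P b c m N) {\<omega>. number_density c N \<omega> \<in> A}"
  have P: "0 < ?P" using assms(2) by (rule less_le_trans[rotated]) simp
  then have "real N * s \<le> ln ?P" using assms(2) by (simp add: ln_ge_iff)
  then have "s \<le> 1 / real N * ln ?P" using assms(1) by (simp add: field_simps)
  then show ?thesis using P by (simp add: log_rate_def ext_ln_def)
qed

subsection \<open>The large deviation principle\<close>

theorem theorem2p1:
  fixes b :: nat and c :: real and m :: "nat \<Rightarrow> nat"
  assumes "c \<in> \<rat>" and "real b < c"
    and "\<forall>N\<in>admissible c. 2 \<le> m N \<and> m N \<le> N"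
    and "filterlim m at_top (along c)"
    and "((\<lambda>N. real (m N)^2 / real N) \<longlongrightarrow> 0) (along c)"
  shows
    "((\<forall>\<theta>\<in>prob_mean b c. rel_entropy b \<theta> (rho b (alpha b c)) \<in> {0..\<infinity>}) \<and>
      (\<forall>M::real. compactin (top_mean b c)
         {\<theta> \<in> prob_mean b c. rel_entropy b \<theta> (rho b (alpha b c)) \<le> ereal M})) \<and>
     (\<forall>F. compactin (top_mean b c) F \<longrightarrow>
        Limsup (along c) (log_rate b c m F) \<le> - rel_entropy_set b F (rho b (alpha b c))) \<and>
     (\<forall>F. closedin (top_mean b c) F \<longrightarrow>
        Limsup (along c) (log_rate b c m F)
          \<le> - rel_entropy_set b (top_mean_between b c closure_of F) (rho b (alpha b c))) \<and>
     (\<forall>G. openin (top_mean b c) G \<longrightarrow>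
        Liminf (along c) (log_rate b c m G) \<ge> - rel_entropy_set b G (rho b (alpha b c)))"
proof -
  let ?\<alpha> = "alpha b c"
  let ?\<rho> = "rho b ?\<alpha>"
  let ?V = "log_volume b ?\<alpha> c"
  let ?e = "count_error c m"
  note m = assms(4)
  have c: "0 < c" using assms(2) by (rule le_less_trans[rotated]) simp
  have \<alpha>: "0 < ?\<alpha>" and \<rho>c: "?\<rho> \<in> prob_mean b c" using alpha_properties[OF assms(2)] by auto
  interpret reference_measure b ?\<rho> by (rule reference_measure_rho[OF \<alpha>])
  have mean_sub: "prob_mean b c \<subseteq> prob_space_b b" by (auto simp: prob_mean_def)
  have ts: "topspace (top_mean b c) = prob_mean b c"
    using mean_sub by (auto simp: top_mean_def topspace_weak_topology)
  have err: "eventually (\<lambda>N. ?e N \<le> real N * \<epsilon>) (along c)" if "0 < \<epsilon>" for \<epsilon>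
    using order_tendstoD(2)[OF count_error_tendsto[OF c assms(5)] that] eventually_along_admissible
  proof eventually_elim
    case (elim N)
    then have "0 < real N" by (simp add: admissible_def)
    then show ?case using elim by (simp add: field_simps)
  qed
  \<comment> \<open>The normalising constant: the whole space is open and contains
    \<open>\<rho>\<close>, whose entropy is 0.\<close>
  have total_lower: "eventually (\<lambda>N. exp (?V N - real N * \<epsilon> - ?e N) \<le> real (config_count b c m UNIV N)) (along c)"
    if "0 < \<epsilon>" for \<epsilon>
  proof -
    have "rel_entropy b ?\<rho> ?\<rho> \<le> ereal 0" by (simp add: rel_entropy_self)
    from type_approximation[OF less_imp_le[OF c] m \<rho>c _ openin_topspace this that]
    have "eventually (\<lambda>N. \<exists>\<nu>\<in>occ_types b c m N. rel_entropy b (pmf_of_multiset \<nu>) ?\<rho> \<le> ereal \<epsilon>) (along c)"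
      using \<rho>c ts by (auto elim: eventually_mono)
    then show ?thesis
      using eventually_along_admissible
    proof eventually_elim
      case (elim N)
      then show ?case using config_count_lower[OF \<alpha>, of N _ b c m UNIV \<epsilon>] by (auto simp: admissible_def)
    qed
  qed
  have nonempty: "constrained_configs b c m N \<noteq> {}" if "exp x \<le> real (config_count b c m A N)" for x A N
    using less_le_trans[OF exp_gt_zero that] by (auto simp: config_count_def)
  have upper: "Limsup (along c) (log_rate b c m F) \<le> - rel_entropy_set b F ?\<rho>" for F
  proof (rule ccontr)
    assume "\<not> ?thesis"
    \<comment> \<open>Two real numbers strictly inside the gap keep the estimates finite even when
      the infimum of the entropy is infinite.\<close>
    then obtain s t where st: "- rel_entropy_set b F ?\<rho> < ereal s" "ereal s < ereal t"
      "ereal t < Limsup (along c) (log_rate b c m F)"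
      by (meson ereal_dense2 not_le)
    have "ereal (- s) < rel_entropy_set b F ?\<rho>"
      using st(1) by (simp add: ereal_uminus_less_reorder)
    then have s: "ereal (- s) \<le> rel_entropy b \<theta> ?\<rho>" if "\<theta> \<in> F" for \<theta>
      using INF_lower[OF that, of "\<lambda>\<theta>. rel_entropy b \<theta> ?\<rho>"] unfolding rel_entropy_set_def by simp
    \<comment> \<open>One third pays for the lower bound on the total count, the other two for the
      counting errors in numerator and denominator.\<close>
    define \<epsilon> where "\<epsilon> = (t - s) / 3"
    have \<epsilon>: "0 < \<epsilon>" using st(2) by (simp add: \<epsilon>_def)
    have "eventually (\<lambda>N. log_rate b c m F N \<le> ereal t) (along c)"
      using total_lower[OF \<epsilon>] err[OF \<epsilon>] eventually_along_admissible
    proof eventually_elim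
      case (elim N)
      have N: "0 < N" using elim by (simp add: admissible_def)
      have "real (config_count b c m F N) \<le> exp (?V N + real N * s + ?e N)"
        using config_count_upper[OF \<alpha> N s, where c = c and m = m] by simp
      then have "real (config_count b c m F N) / real (config_count b c m UNIV N)
          \<le> exp (?V N + real N * s + ?e N) / exp (?V N - real N * \<epsilon> - ?e N)"
        by (intro frac_le elim(1)) auto
      also have "\<dots> = exp (real N * s + real N * \<epsilon> + 2 * ?e N)"
        by (simp add: exp_diff[symmetric])
      also have "\<dots> \<le> exp (real N * t)"
      proof -
        have "real N * s + real N * \<epsilon> + 2 * ?e N \<le> real N * s + real N * \<epsilon> + 2 * (real N * \<epsilon>)"
          using elim(2) by linarith
        also have "\<dots> = real N * t" by (simp add: \<epsilon>_def field_simps)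
        finally show ?thesis by simp
      qed
      finally show ?case
        by (intro log_rate_le[OF N]) (simp add: prob_uniform_P[OF nonempty[OF elim(1)]])
    qed
    then have "Limsup (along c) (log_rate b c m F) \<le> ereal t" by (rule Limsup_bounded)
    then show False using st(3) by simp
  qed
  have lower: "- rel_entropy_set b G ?\<rho> \<le> Liminf (along c) (log_rate b c m G)"
    if G: "openin (top_mean b c) G" for G
  proof (rule ccontr)
    assume "\<not> ?thesis"
    then obtain s t where st: "Liminf (along c) (log_rate b c m G) < ereal s" "ereal s < ereal t"
      "ereal t < - rel_entropy_set b G ?\<rho>"
      by (meson ereal_dense2 not_le)
    have "rel_entropy_set b G ?\<rho> < ereal (- t)"
      using st(3) by (metis ereal_less_uminus_reorder uminus_ereal.simps(1))
    then obtain \<theta> where \<theta>: "\<theta> \<in> G" "rel_entropy b \<theta> ?\<rho> \<le> ereal (- t)"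
      by (auto simp: rel_entropy_set_def INF_less_iff intro: less_imp_le)
    \<comment> \<open>One third pays for replacing \<theta> by a type, two for the counting
      errors.\<close>
    define \<epsilon> where "\<epsilon> = (t - s) / 3"
    have \<epsilon>: "0 < \<epsilon>" using st(2) by (simp add: \<epsilon>_def)
    have "eventually (\<lambda>N. ereal s \<le> log_rate b c m G N) (along c)"
      using type_approximation[OF less_imp_le[OF c] m \<rho>c \<theta>(1) G \<theta>(2) \<epsilon>] err[OF \<epsilon>] eventually_along_admissible
    proof eventually_elim
      case (elim N)
      have N: "0 < N" using elim by (simp add: admissible_def)
      obtain \<nu> where "\<nu> \<in> occ_types b c m N" "pmf_of_multiset \<nu> \<in> G"
        "rel_entropy b (pmf_of_multiset \<nu>) ?\<rho> \<le> ereal (- t + \<epsilon>)" using elim(1) by auto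
      from config_count_lower[OF \<alpha> N this]
      have low: "exp (?V N - real N * (- t + \<epsilon>) - ?e N) \<le> real (config_count b c m G N)" .
      have "config_count b c m G N \<le> config_count b c m UNIV N"
        unfolding config_count_def by (rule card_mono) auto
      then have pos: "0 < real (config_count b c m UNIV N)"
        using less_le_trans[OF exp_gt_zero low] by linarith
      \<comment> \<open>Nonnegativity of entropy is the case r = 0 of the upper count.\<close>
      have high: "real (config_count b c m UNIV N) \<le> exp (?V N + ?e N)"
        using config_count_upper[OF \<alpha> N, where A = UNIV and r = 0 and c = c and m = m and b = b]
          rel_entropy_nonneg by (simp add: zero_ereal_def)
      have "exp (real N * s) \<le> exp (real N * t - real N * \<epsilon> - 2 * ?e N)"
      proof -
        have "real N * s = real N * t - real N * \<epsilon> - 2 * (real N * \<epsilon>)" by (simp add: \<epsilon>_def field_simps)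
        also have "\<dots> \<le> real N * t - real N * \<epsilon> - 2 * ?e N" using elim(2) by linarith
        finally show ?thesis by simp
      qed
      also have "\<dots> = exp (?V N - real N * (- t + \<epsilon>) - ?e N) / exp (?V N + ?e N)"
        by (simp add: exp_diff[symmetric] algebra_simps)
      also have "\<dots> \<le> real (config_count b c m G N) / real (config_count b c m UNIV N)"
        using low high pos by (intro frac_le) auto
      finally show ?case
        by (intro log_rate_ge[OF N]) (simp add: prob_uniform_P[OF nonempty[OF low]])
    qed
    then have "ereal s \<le> Liminf (along c) (log_rate b c m G)" by (rule Liminf_bounded)
    then show False using st(1) by simp
  qed
  have closed_case: "Limsup (along c) (log_rate b c m F)
      \<le> - rel_entropy_set b (top_mean_between b c closure_of F) ?\<rho>"
    if F: "closedin (top_mean b c) F" for F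
  proof -
    have "F \<subseteq> prob_mean b c" using closedin_subset[OF F] ts by simp
    also have "\<dots> \<subseteq> topspace (top_mean_between b c)"
      using assms(2) by (auto simp: top_mean_between_def topspace_weak_topology prob_mean_def prob_mean_between_def)
    finally have "F \<subseteq> top_mean_between b c closure_of F" by (rule closure_of_subset)
    then have "rel_entropy_set b (top_mean_between b c closure_of F) ?\<rho> \<le> rel_entropy_set b F ?\<rho>"
      unfolding rel_entropy_set_def by (rule INF_superset_mono) simp
    then show ?thesis using upper[of F] by (meson ereal_minus_le_minus order_trans)
  qed
  have "compactin (top_mean b c) {\<theta> \<in> prob_mean b c. rel_entropy b \<theta> ?\<rho> \<le> ereal M}" for M
    by (rule compactin_level_set[OF rho_exp_moment_summable[OF \<alpha>]])
  moreover have "rel_entropy b \<theta> ?\<rho> \<in> {0..\<infinity>}" if "\<theta> \<in> prob_mean b c" for \<theta>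
    using rel_entropy_nonneg that mean_sub by auto
  ultimately show ?thesis using upper lower closed_case by blast
qed

end
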